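(* There is a $2$-letter universal sequence for $\operatorname{Aut}(\mathbb{Q},\leq)$. That is, if $A$ is an alphabet with exactly two elements, there exists a sequence $w_1,w_2,\ldots$ of elements of the free semigroup $A^+$ such that for every sequence $f_1,f_2,\ldots$ of elements of $\operatorname{Aut}(\mathbb{Q},\leq)$ there is a semigroup homomorphism $\phi:A^+\to\operatorname{Aut}(\mathbb{Q},\leq)$ with $(w_i)\phi=f_i$ for all $i\in\mathbb{N}$.
   Context: $\mathbb{N}=\{1,2,3,\ldots\}$. $\operatorname{Aut}(\mathbb{Q},\leq)$ is the group (under composition) of all order-automorphisms of $\mathbb{Q}$, i.e. bijections $f:\mathbb{Q}\to\mathbb{Q}$ with $x\leq y$ if and only if $(x)f\leq (y)f$. Functions are written to the right of their arguments and composed from left to right. For an alphabet $A$, $A^+$ is the free semigroup freely generated by $A$ (non-empty words over $A$). Let $S$ be a semigroup and $T\subseteq S$. A sequence $w_1,w_2,\ldots$ of elements of $A^+$ is universal for $T$ as a subset of $S$ if for every sequence $t_1,t_2,\ldots\in T$ there is a semigroup homomorphism $\phi:A^+\to S$ with $(w_i)\phi=t_i$ for all $i\in\mathbb{N}$. It is universal for $S$ if it is universal for $S$ as a subset of $S$, and it is an $m$-letter universal sequence if $|A|=m$. *)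

theory Defs
  imports "HOL-Algebra.Group" HOL.Rat
begin

(* HOL-Algebra has no separate record for semigroups, so semigroups are "monoid" records
   of which only carrier and mult are used: hom never looks at the field one.
   In particular one = [] below is not an element of the free semigroup. *)
definition free_semigroup :: "'a set \<Rightarrow> 'a list monoid" where
  "free_semigroup A = \<lparr>carrier = {w. w \<noteq> [] \<and> set w \<subseteq> A}, mult = (@), one = []\<rparr>"

(* Functions act on the right, so the product of f and g is "first f, then g". *)
definition Aut_rat :: "(rat \<Rightarrow> rat) monoid" where
  "Aut_rat = \<lparr>carrier = {f. bij f \<and> (\<forall>x y. x \<le> y \<longleftrightarrow> f x \<le> f y)},
              mult = (\<lambda>f g. g \<circ> f), one = id\<rparr>"

(* Sequences are indexed by the positive integers; their value at 0 is irrelevant. *)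
definition universal_as_subset ::
    "'a set \<Rightarrow> ('b, 'c) monoid_scheme \<Rightarrow> 'b set \<Rightarrow> (nat \<Rightarrow> 'a list) \<Rightarrow> bool" where
  "universal_as_subset A S T w \<longleftrightarrow>
     w \<in> {1..} \<rightarrow> carrier (free_semigroup A) \<and>
     (\<forall>t \<in> {1..} \<rightarrow> T. \<exists>\<phi> \<in> hom (free_semigroup A) S. \<forall>i\<ge>1. \<phi> (w i) = t i)"

definition universal_sequence ::
    "'a set \<Rightarrow> ('b, 'c) monoid_scheme \<Rightarrow> (nat \<Rightarrow> 'a list) \<Rightarrow> bool" where
  "universal_sequence A S w \<longleftrightarrow> universal_as_subset A S (carrier S) w"

definition letter_universal_sequence ::
    "nat \<Rightarrow> 'a set \<Rightarrow> ('b, 'c) monoid_scheme \<Rightarrow> (nat \<Rightarrow> 'a list) \<Rightarrow> bool" where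
  "letter_universal_sequence m A S w \<longleftrightarrow> finite A \<and> card A = m \<and> universal_sequence A S w"

lemma free_semigroup_closed:
  "u \<in> carrier (free_semigroup A) \<Longrightarrow> v \<in> carrier (free_semigroup A) \<Longrightarrow>
     u \<otimes>\<^bsub>free_semigroup A\<^esub> v \<in> carrier (free_semigroup A)"
  by (simp add: free_semigroup_def)

lemma group_Aut_rat: "group Aut_rat"
proof (rule groupI)
  fix f assume f: "f \<in> carrier Aut_rat"
  then have b: "bij f" and m: "\<And>x y. x \<le> y \<longleftrightarrow> f x \<le> f y"
    by (auto simp: Aut_rat_def)
  have s: "f (inv_into UNIV f x) = x" for x
    using b by (simp add: bij_is_surj surj_f_inv_f)
  have "x \<le> y \<longleftrightarrow> inv_into UNIV f x \<le> inv_into UNIV f y" for x y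
    using m[of "inv_into UNIV f x" "inv_into UNIV f y"] by (simp add: s)
  then have "inv_into UNIV f \<in> carrier Aut_rat"
    using b by (simp add: Aut_rat_def bij_imp_bij_inv)
  moreover have "inv_into UNIV f \<otimes>\<^bsub>Aut_rat\<^esub> f = \<one>\<^bsub>Aut_rat\<^esub>"
    by (simp add: Aut_rat_def fun_eq_iff s)
  ultimately show "\<exists>g\<in>carrier Aut_rat. g \<otimes>\<^bsub>Aut_rat\<^esub> f = \<one>\<^bsub>Aut_rat\<^esub>" by blast
next
  fix f g assume f: "f \<in> carrier Aut_rat" and g: "g \<in> carrier Aut_rat"
  from f have bf: "bij f" and mf: "\<And>x y. f x \<le> f y \<longleftrightarrow> x \<le> y" by (auto simp: Aut_rat_def)
  from g have bg: "bij g" and mg: "\<And>x y. g x \<le> g y \<longleftrightarrow> x \<le> y" by (auto simp: Aut_rat_def)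
  show "f \<otimes>\<^bsub>Aut_rat\<^esub> g \<in> carrier Aut_rat"
    using bij_comp[OF bf bg] by (simp add: Aut_rat_def mf mg)
qed (simp_all add: Aut_rat_def comp_assoc)

end

(* Functions compose from left to right. Let a be the translation by 1 and b = a^(-40) X, where X
   preserves every interval [8n, 8n+8). For q in Z and s = (-1)^q let X act on the cells 5q, 5q+1
   and 5q+4 as c^(s(4q+1)), e^s and x^s, for fixed automorphisms c, e, x of the cell [0, 8), and
   trivially on the other cells. Then a^120 b b a^40 b b = 1 because s(4q+1) is annihilated by
   (1 + shift)^2, so inverses of a and b are positive words.

   The commutator of X^(2^i) X_1 X^(-2^i) with X_4 (X_j being X conjugated by a^(8j)) is supported
   on the cells 5q and acts there as [c^K e^s c^(-K), x^s] with K = s 2^i (4q+1). Since the K are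
   distinct for distinct (i, q), e can carry independent data on each interval c^K [1, 7), and a
   swindle makes these commutators arbitrary automorphisms supported in [2, 6).

   Every sequence f_i is conjugate, by a single automorphism, to one with f_i at bounded distance
   2i + 2 from the identity. Clamping in the lattice-ordered group Aut(Q) splits f_i into 2i + 2
   factors moving points by at most 1, and each of these is a product of 20 automorphisms which are
   a-conjugates of the ones obtained above. *)

theory Submission
  imports Defs "HOL-Library.Nat_Bijection"
begin

section \<open>Positive words in two letters subject to a positive relation\<close>

definition word_eval :: "('g, 'c) monoid_scheme \<Rightarrow> ('a \<Rightarrow> 'g) \<Rightarrow> 'a list \<Rightarrow> 'g" where
  "word_eval G s w = foldr (\<lambda>l g. s l \<otimes>\<^bsub>G\<^esub> g) w \<one>\<^bsub>G\<^esub>"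

definition two_letters :: "'a \<Rightarrow> 'g \<Rightarrow> 'g \<Rightarrow> 'a \<Rightarrow> 'g" where
  "two_letters \<alpha> a b l = (if l = \<alpha> then a else b)"

text \<open>The relator is a positive word containing both letters, so in any group where it is trivial the
  inverses of \<open>a\<close> and \<open>b\<close> are values of positive words. With \<open>b = inv (a ^ k) X\<close> and
  \<open>X\<^sub>j = a ^ (jk) X inv (a ^ (jk))\<close> it reads \<open>X\<^sub>2 X\<^sub>1 X\<^sub>1 X\<^sub>0\<close>.\<close>

definition related :: "('g, 'c) monoid_scheme \<Rightarrow> nat \<Rightarrow> 'g \<Rightarrow> 'g \<Rightarrow> bool" where
  "related G k a b \<longleftrightarrow> a \<in> carrier G \<and> b \<in> carrier G \<and>
     a [^]\<^bsub>G\<^esub> (3 * k) \<otimes>\<^bsub>G\<^esub> (b \<otimes>\<^bsub>G\<^esub> b \<otimes>\<^bsub>G\<^esub> a [^]\<^bsub>G\<^esub> k \<otimes>\<^bsub>G\<^esub> b \<otimes>\<^bsub>G\<^esub> b) = \<one>\<^bsub>G\<^esub>"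

text \<open>The word is quantified before \<open>a\<close> and \<open>b\<close>: one word has to
  serve all related pairs, because a universal sequence is fixed before its targets are
  known.\<close>

definition expressible ::
    "('g, 'c) monoid_scheme \<Rightarrow> nat \<Rightarrow> 'a \<Rightarrow> 'a \<Rightarrow> ('g \<Rightarrow> 'g \<Rightarrow> 'g) \<Rightarrow> bool" where
  "expressible G k \<alpha> \<beta> F \<longleftrightarrow>
     (\<exists>w. w \<noteq> [] \<and> set w \<subseteq> {\<alpha>, \<beta>} \<and>
        (\<forall>a b. related G k a b \<longrightarrow> word_eval G (two_letters \<alpha> a b) w = F a b))"

context group
begin

lemma word_eval_Nil [simp]: "word_eval G s [] = \<one>"
  and word_eval_Cons [simp]: "word_eval G s (l # w) = s l \<otimes> word_eval G s w"
  by (simp_all add: word_eval_def)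

lemma word_eval_closed [simp]: "(\<And>l. s l \<in> carrier G) \<Longrightarrow> word_eval G s w \<in> carrier G"
  by (induction w) simp_all

lemma word_eval_append:
  "(\<And>l. s l \<in> carrier G) \<Longrightarrow> word_eval G s (v @ w) = word_eval G s v \<otimes> word_eval G s w"
  by (induction v) (simp_all add: m_assoc)

lemma word_eval_replicate:
  "s l \<in> carrier G \<Longrightarrow> word_eval G s (replicate n l) = s l [^] n"
  by (induction n) (simp_all only: replicate_Suc replicate_0 word_eval_Nil word_eval_Cons nat_pow_Suc2 nat_pow_0)

lemma word_eval_inverse:
  assumes s: "\<And>l. s l \<in> carrier G" and v: "\<And>l. l \<in> set w \<Longrightarrow> word_eval G s (v l) = inv (s l)"
  shows "word_eval G s (concat (map v (rev w))) = inv (word_eval G s w)"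
  using v by (induction w) (simp_all add: word_eval_append s inv_mult_group)

lemma relatedD:
  assumes "related G k a b"
  shows "a \<in> carrier G" "b \<in> carrier G"
  using assms by (simp_all add: related_def)

lemma two_letters_closed: "related G k a b \<Longrightarrow> two_letters \<alpha> a b l \<in> carrier G"
  by (simp add: two_letters_def relatedD)

lemma letter_inverse_words:
  fixes \<alpha> \<beta> :: 'l
  assumes "\<alpha> \<noteq> \<beta>" "k > 0"
  obtains v where "\<And>l. l \<in> {\<alpha>, \<beta>} \<Longrightarrow> v l \<noteq> [] \<and> set (v l) \<subseteq> {\<alpha>, \<beta>}"
    and "\<And>l a b. l \<in> {\<alpha>, \<beta>} \<Longrightarrow> related G k a b \<Longrightarrow>
           word_eval G (two_letters \<alpha> a b) (v l) = inv (two_letters \<alpha> a b l)"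
proof -
  \<comment> \<open>Without its first letter, a trivial word evaluates to the inverse of that
    letter. \<open>va\<close> is the relator without its first \<open>\<alpha>\<close>;
    \<open>vb\<close> comes from the cyclic rotation that starts with
    \<open>\<beta>\<close>.\<close>
  define va where "va = replicate (3 * k - 1) \<alpha> @ [\<beta>, \<beta>] @ replicate k \<alpha> @ [\<beta>, \<beta>]"
  define vb where "vb = [\<beta>] @ replicate k \<alpha> @ [\<beta>, \<beta>] @ replicate (3 * k) \<alpha>"
  define v where "v = (\<lambda>l. if l = \<alpha> then va else vb)"
  have "word_eval G (two_letters \<alpha> a b) va = inv a \<and> word_eval G (two_letters \<alpha> a b) vb = inv b"
    if r: "related G k a b" for a b
  proof -
    let ?s = "two_letters \<alpha> a b"
    have s: "\<And>l. ?s l \<in> carrier G" "?s \<alpha> = a" "?s \<beta> = b"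
      by (rule two_letters_closed[OF r]) (use assms in \<open>auto simp: two_letters_def\<close>)
    note c = relatedD[OF r]
    let ?u = "b \<otimes> b \<otimes> a [^] k \<otimes> b \<otimes> b"
    have rel: "a [^] (3 * k) \<otimes> ?u = \<one>" using r by (simp add: related_def)
    have k: "3 * k = Suc (3 * k - 1)" using assms by simp
    have "word_eval G ?s va = a [^] (3 * k - 1) \<otimes> ?u"
      using c s by (simp add: va_def word_eval_append word_eval_replicate m_assoc)
    then have "a \<otimes> word_eval G ?s va = a [^] (Suc (3 * k - 1)) \<otimes> ?u"
      using c by (simp only: nat_pow_Suc2) (simp add: m_assoc)
    then have "a \<otimes> word_eval G ?s va = \<one>" using rel k by metis
    then have "word_eval G ?s va = inv a"
      using c s by (intro inv_equality[OF inv_comm, symmetric]) simp_all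
    moreover have "?u \<otimes> a [^] (3 * k) = \<one>"
      by (rule inv_comm[OF rel]) (use c in auto)
    then have "b \<otimes> word_eval G ?s vb = \<one>"
      using c s by (simp add: vb_def word_eval_append word_eval_replicate m_assoc)
    then have "word_eval G ?s vb = inv b"
      using c s by (intro inv_equality[OF inv_comm, symmetric]) simp_all
    ultimately show ?thesis ..
  qed
  then show ?thesis
    using assms by (intro that[of v]) (auto simp: v_def va_def vb_def two_letters_def)
qed

lemma expressible_fst: "expressible G k \<alpha> \<beta> (\<lambda>a b. a)"
  unfolding expressible_def
  by (rule exI[of _ "[\<alpha>]"]) (auto simp: two_letters_def relatedD)

lemma expressible_snd: "\<alpha> \<noteq> \<beta> \<Longrightarrow> expressible G k \<alpha> \<beta> (\<lambda>a b. b)"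
  unfolding expressible_def
  by (rule exI[of _ "[\<beta>]"]) (auto simp: two_letters_def relatedD)

lemma expressible_mult:
  assumes "expressible G k \<alpha> \<beta> F" "expressible G k \<alpha> \<beta> F'"
  shows "expressible G k \<alpha> \<beta> (\<lambda>a b. F a b \<otimes> F' a b)"
proof -
  obtain w w' where
    "w \<noteq> []" "set w \<subseteq> {\<alpha>, \<beta>}" "\<And>a b. related G k a b \<Longrightarrow> word_eval G (two_letters \<alpha> a b) w = F a b"
    "w' \<noteq> []" "set w' \<subseteq> {\<alpha>, \<beta>}" "\<And>a b. related G k a b \<Longrightarrow> word_eval G (two_letters \<alpha> a b) w' = F' a b"
    using assms unfolding expressible_def by blast
  then show ?thesis
    unfolding expressible_def
    by (intro exI[of _ "w @ w'"]) (simp add: word_eval_append two_letters_closed)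
qed

lemma expressible_inv:
  assumes F: "expressible G k \<alpha> \<beta> F" and "\<alpha> \<noteq> \<beta>" "k > 0"
  shows "expressible G k \<alpha> \<beta> (\<lambda>a b. inv (F a b))"
proof -
  obtain w where w: "w \<noteq> []" "set w \<subseteq> {\<alpha>, \<beta>}"
    "\<And>a b. related G k a b \<Longrightarrow> word_eval G (two_letters \<alpha> a b) w = F a b"
    using F unfolding expressible_def by blast
  obtain v where v: "\<And>l. l \<in> {\<alpha>, \<beta>} \<Longrightarrow> v l \<noteq> [] \<and> set (v l) \<subseteq> {\<alpha>, \<beta>}"
    and vi: "\<And>l a b. l \<in> {\<alpha>, \<beta>} \<Longrightarrow> related G k a b \<Longrightarrow>
           word_eval G (two_letters \<alpha> a b) (v l) = inv (two_letters \<alpha> a b l)"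
    using letter_inverse_words[OF assms(2,3)] by blast
  let ?w = "concat (map v (rev w))"
  have "word_eval G (two_letters \<alpha> a b) ?w = inv (F a b)" if r: "related G k a b" for a b
    unfolding w(3)[OF r, symmetric]
    using two_letters_closed[OF r] by (rule word_eval_inverse) (rule vi[OF subsetD[OF w(2)] r])
  moreover have "?w \<noteq> []"
    using w(1) v[OF subsetD[OF w(2)]] by (cases w) simp_all
  moreover have "set ?w \<subseteq> {\<alpha>, \<beta>}"
    unfolding set_concat set_map set_rev using v[OF subsetD[OF w(2)]] by (simp add: UN_subset_iff)
  ultimately show ?thesis unfolding expressible_def by (intro exI[of _ ?w] conjI allI impI)
qed

text \<open>The empty word is not in the free semigroup, so the identity is obtained as
  \<open>a\<close> times the positive word for its inverse.\<close>

lemma expressible_one: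
  assumes "\<alpha> \<noteq> \<beta>" "k > 0"
  shows "expressible G k \<alpha> \<beta> (\<lambda>a b. \<one>)"
proof -
  have "expressible G k \<alpha> \<beta> (\<lambda>a b. a \<otimes> inv a)"
    by (rule expressible_mult[OF expressible_fst expressible_inv[OF expressible_fst assms]])
  then show ?thesis unfolding expressible_def by (simp add: relatedD cong: conj_cong)
qed

lemma expressible_nat_pow:
  assumes "expressible G k \<alpha> \<beta> F" "\<alpha> \<noteq> \<beta>" "k > 0"
  shows "expressible G k \<alpha> \<beta> (\<lambda>a b. F a b [^] (n::nat))"
  by (induction n) (simp_all add: expressible_one expressible_mult assms)

lemma expressible_int_pow:
  assumes "expressible G k \<alpha> \<beta> F" "\<alpha> \<noteq> \<beta>" "k > 0"
  shows "expressible G k \<alpha> \<beta> (\<lambda>a b. F a b [^] (n::int))"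
proof (cases n)
  case (nonneg m)
  then show ?thesis using expressible_nat_pow[OF assms, of m] by (simp add: int_pow_int)
next
  case (neg m)
  have "expressible G k \<alpha> \<beta> (\<lambda>a b. inv (F a b [^] Suc m))"
    by (intro expressible_inv expressible_nat_pow assms)
  moreover have "x [^] n = inv (x [^] Suc m)" for x
    by (simp add: neg int_pow_def2 del: nat_pow_Suc of_nat_Suc)
  ultimately show ?thesis by simp
qed

end

section \<open>Order-automorphisms of the rationals\<close>

abbreviation Aut :: "(rat \<Rightarrow> rat) set" where
  "Aut \<equiv> carrier Aut_rat"

abbreviation aut_mult :: "(rat \<Rightarrow> rat) \<Rightarrow> (rat \<Rightarrow> rat) \<Rightarrow> rat \<Rightarrow> rat" (infixl "\<bullet>" 70) where
  "f \<bullet> g \<equiv> f \<otimes>\<^bsub>Aut_rat\<^esub> g"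

abbreviation aut_inv :: "(rat \<Rightarrow> rat) \<Rightarrow> rat \<Rightarrow> rat" where
  "aut_inv f \<equiv> inv\<^bsub>Aut_rat\<^esub> f"

abbreviation aut_pow :: "(rat \<Rightarrow> rat) \<Rightarrow> int \<Rightarrow> rat \<Rightarrow> rat" (infixr "\<up>" 75) where
  "f \<up> k \<equiv> f [^]\<^bsub>Aut_rat\<^esub> k"

interpretation Aut: group Aut_rat
  by (rule group_Aut_rat)

lemma mult_apply [simp]: "(f \<bullet> g) x = g (f x)"
  and one_apply [simp]: "\<one>\<^bsub>Aut_rat\<^esub> x = x"
  by (simp_all add: Aut_rat_def)

lemma AutI:
  assumes "\<And>x y. x < y \<Longrightarrow> f x < f y" "\<And>y. \<exists>x. f x = y"
  shows "f \<in> Aut"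
proof -
  have "strict_mono f" using assms(1) by (simp add: strict_mono_def)
  then have "inj f" "\<And>x y. x \<le> y \<longleftrightarrow> f x \<le> f y"
    by (simp_all add: strict_mono_imp_inj_on strict_mono_less_eq)
  moreover have "surj f" using assms(2) by (metis surj_def)
  ultimately show ?thesis by (simp add: Aut_rat_def bij_def)
qed

lemma Aut_le_iff: "f \<in> Aut \<Longrightarrow> f x \<le> f y \<longleftrightarrow> x \<le> y"
  by (simp add: Aut_rat_def)

lemma Aut_less_iff: "f \<in> Aut \<Longrightarrow> f x < f y \<longleftrightarrow> x < y"
  by (simp add: Aut_le_iff flip: not_le)

lemma Aut_eq_iff: "f \<in> Aut \<Longrightarrow> f x = f y \<longleftrightarrow> x = y"
  by (simp add: Aut_le_iff order_eq_iff)

lemma aut_inv_apply [simp]: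
  assumes "f \<in> Aut"
  shows "f (aut_inv f x) = x" "aut_inv f (f x) = x"
  using fun_cong[OF Aut.l_inv[OF assms], of x] fun_cong[OF Aut.r_inv[OF assms], of x] by simp_all

lemma aut_inv_le: "f \<in> Aut \<Longrightarrow> aut_inv f x \<le> y \<longleftrightarrow> x \<le> f y"
  by (metis Aut_le_iff aut_inv_apply(1))

lemma aut_pow_0 [simp]: "(f \<up> 0) x = x"
  by simp

lemma aut_pow_add: "f \<in> Aut \<Longrightarrow> (f \<up> (k + l)) x = (f \<up> l) ((f \<up> k) x)"
  by (simp add: Aut.int_pow_mult)

lemma aut_pow_minus: "f \<in> Aut \<Longrightarrow> (f \<up> (- k)) ((f \<up> k) x) = x"
  by (simp flip: aut_pow_add)

lemma aut_pow_Suc: "f \<in> Aut \<Longrightarrow> (f \<up> (k + 1)) x = f ((f \<up> k) x)"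
  by (simp add: aut_pow_add Aut.int_pow_1)

section \<open>Lattice operations and affine maps\<close>

lemma aut_max:
  assumes f: "f \<in> Aut" and g: "g \<in> Aut"
  shows "(\<lambda>x. max (f x) (g x)) \<in> Aut"
proof (rule AutI)
  fix x y :: rat assume "x < y"
  then have "f x < f y" "g x < g y" using f g by (simp_all add: Aut_less_iff)
  then show "max (f x) (g x) < max (f y) (g y)" by (auto simp: max_def)
next
  fix y
  \<comment> \<open>The smaller of the two preimages of \<open>y\<close> works for the maximum;
    dually, the larger one for the minimum.\<close>
  show "\<exists>x. max (f x) (g x) = y"
  proof (cases "aut_inv f y \<le> aut_inv g y")
    case True
    then have "g (aut_inv f y) \<le> y" using g by (metis Aut_le_iff aut_inv_apply(1))
    then show ?thesis using f by (intro exI[of _ "aut_inv f y"]) simp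
  next
    case False
    then have "f (aut_inv g y) \<le> y" using f by (metis Aut_le_iff aut_inv_apply(1) linear)
    then show ?thesis using g by (intro exI[of _ "aut_inv g y"]) simp
  qed
qed

lemma aut_min:
  assumes f: "f \<in> Aut" and g: "g \<in> Aut"
  shows "(\<lambda>x. min (f x) (g x)) \<in> Aut"
proof (rule AutI)
  fix x y :: rat assume "x < y"
  then have "f x < f y" "g x < g y" using f g by (simp_all add: Aut_less_iff)
  then show "min (f x) (g x) < min (f y) (g y)" by (auto simp: min_def)
next
  fix y
  show "\<exists>x. min (f x) (g x) = y"
  proof (cases "aut_inv f y \<le> aut_inv g y")
    case True
    then have "y \<le> f (aut_inv g y)" using f by (metis Aut_le_iff aut_inv_apply(1))
    then show ?thesis using g by (intro exI[of _ "aut_inv g y"]) simp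
  next
    case False
    then have "y \<le> g (aut_inv f y)" using g by (metis Aut_le_iff aut_inv_apply(1) linear)
    then show ?thesis using f by (intro exI[of _ "aut_inv f y"]) simp
  qed
qed

lemma affine_aut:
  assumes "\<alpha> > 0"
  shows "(\<lambda>x. \<alpha> * x + \<beta>) \<in> Aut"
proof (rule AutI)
  fix y :: rat
  show "\<exists>x. \<alpha> * x + \<beta> = y" using assms by (intro exI[of _ "(y - \<beta>) / \<alpha>"]) simp
qed (use assms in simp)

lemma translation_aut: "(\<lambda>x. x + \<beta>) \<in> Aut"
  using affine_aut[of 1 \<beta>] by simp

subsection \<open>Supports\<close>

definition supported :: "('b \<Rightarrow> 'b) \<Rightarrow> 'b set \<Rightarrow> bool" where
  "supported f S \<longleftrightarrow> (\<forall>x. x \<notin> S \<longrightarrow> f x = x)"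

lemma supportedD: "supported f S \<Longrightarrow> x \<notin> S \<Longrightarrow> f x = x"
  by (simp add: supported_def)

lemma supported_mono: "supported f S \<Longrightarrow> S \<subseteq> S' \<Longrightarrow> supported f S'"
  by (auto simp: supported_def)

lemma supported_mem_iff:
  assumes "f \<in> Aut" "supported f S"
  shows "f x \<in> S \<longleftrightarrow> x \<in> S"
  using assms by (metis Aut_eq_iff supportedD)

lemma supported_one [simp]: "supported (\<one>\<^bsub>Aut_rat\<^esub>) S"
  by (simp add: supported_def)

lemma supported_mult: "supported f S \<Longrightarrow> supported g S \<Longrightarrow> supported (f \<bullet> g) S"
  by (simp add: supported_def)

lemma supported_inv: "f \<in> Aut \<Longrightarrow> supported f S \<Longrightarrow> supported (aut_inv f) S"
  by (metis aut_inv_apply(2) supported_def)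

lemma supported_nat_pow: "supported f S \<Longrightarrow> supported (f [^]\<^bsub>Aut_rat\<^esub> (n::nat)) S"
  by (induction n) (simp_all add: supported_mult)

lemma supported_int_pow: "f \<in> Aut \<Longrightarrow> supported f S \<Longrightarrow> supported (f \<up> k) S"
  by (cases k)
    (simp_all only: Aut.int_pow_neg int_pow_int supported_inv supported_nat_pow Aut.nat_pow_closed)

subsection \<open>Products of automorphisms with disjoint supports\<close>

text \<open>For pairwise disjoint \<open>S i\<close> with \<open>g i\<close> supported in
  \<open>S i\<close>, this is the possibly infinite product of the \<open>g i\<close>; no order of
  the factors has to be chosen.\<close>

definition disjoint_product :: "('i \<Rightarrow> 'b set) \<Rightarrow> ('i \<Rightarrow> 'b \<Rightarrow> 'b) \<Rightarrow> 'b \<Rightarrow> 'b" where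
  "disjoint_product S g x = (if \<exists>i. x \<in> S i then g (THE i. x \<in> S i) x else x)"

lemma disjoint_product_apply:
  assumes "\<And>i j x. x \<in> S i \<Longrightarrow> x \<in> S j \<Longrightarrow> i = j" "x \<in> S i"
  shows "disjoint_product S g x = g i x"
proof -
  have "(THE i. x \<in> S i) = i" by (rule the_equality[of "\<lambda>i. x \<in> S i", OF assms(2)]) (rule assms(1)[OF _ assms(2)])
  then show ?thesis using assms(2) by (auto simp: disjoint_product_def)
qed

lemma disjoint_product_outside: "(\<And>i. x \<notin> S i) \<Longrightarrow> disjoint_product S g x = x"
  by (simp add: disjoint_product_def)

text \<open>The supports may interleave. For \<open>x\<close> in \<open>S i\<close> below
  \<open>y\<close> in another \<open>S j\<close>, apply both factors in turn: \<open>g i\<close>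
  fixes \<open>y\<close>, and \<open>g j\<close> fixes \<open>g i x\<close>, which is still in
  \<open>S i\<close>.\<close>

lemma disjoint_product_aut:
  assumes disj: "\<And>i j x. x \<in> S i \<Longrightarrow> x \<in> S j \<Longrightarrow> i = j"
    and g: "\<And>i. g i \<in> Aut" and supp: "\<And>i. supported (g i) (S i)"
  shows "disjoint_product S g \<in> Aut"
proof (rule AutI)
  let ?P = "disjoint_product S g"
  have P: "x \<in> S i \<Longrightarrow> ?P x = g i x" for x i
    by (rule disjoint_product_apply[OF disj])
  fix x y :: rat assume less: "x < y"
  show "?P x < ?P y"
  proof (cases "\<exists>i. x \<in> S i")
    case True
    then obtain i where i: "x \<in> S i" by blast
    show ?thesis
    proof (cases "\<exists>j. y \<in> S j \<and> j \<noteq> i")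
      case True
      then obtain j where j: "y \<in> S j" "j \<noteq> i" by blast
      then have "y \<notin> S i" using disj[of y i j] by auto
      then have "g i y = y" by (rule supportedD[OF supp])
      then have "g i x < y"
        using less Aut_less_iff[OF g, of i x y] by simp
      moreover have "g i x \<in> S i" using i supported_mem_iff[OF g supp] by simp
      then have "g i x \<notin> S j" using j(2) disj[of _ i j] by auto
      then have "g j (g i x) = g i x" by (rule supportedD[OF supp])
      ultimately have "g i x < g j y"
        using Aut_less_iff[OF g, of j "g i x" y] by simp
      then show ?thesis by (simp only: P[OF i] P[OF j(1)])
    next
      case other: False
      have "?P y = g i y"
      proof (cases "y \<in> S i")
        case False
        then have "y \<notin> S j" for j using other by metis
        then have "?P y = y" by (rule disjoint_product_outside)
        then show ?thesis using supportedD[OF supp False] by simp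
      qed (rule P)
      then show ?thesis using P[OF i] less g by (simp add: Aut_less_iff)
    qed
  next
    case False
    then have x: "?P x = x" by (simp add: disjoint_product_outside)
    show ?thesis
    proof (cases "\<exists>j. y \<in> S j")
      case True
      then obtain j where j: "y \<in> S j" by blast
      have "x < g j y"
        using less Aut_less_iff[OF g, of j x y] supportedD[OF supp, of x j] False by simp
      then show ?thesis using x P[OF j] by simp
    qed (use x less in \<open>simp add: disjoint_product_outside\<close>)
  qed
next
  fix y
  show "\<exists>x. disjoint_product S g x = y"
  proof (cases "\<exists>i. y \<in> S i")
    case True
    then obtain i where i: "y \<in> S i" by blast
    then have "aut_inv (g i) y \<in> S i"
      using supported_mem_iff[OF _ supported_inv[OF g supp]] g by simp
    then have "disjoint_product S g (aut_inv (g i) y) = y"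
      using g by (simp add: disjoint_product_apply[of S, OF disj])
    then show ?thesis by blast
  qed (use disjoint_product_outside[of y S g] in auto)
qed

subsection \<open>Piecewise linear automorphisms\<close>

lemma piecewise_linear_aut:
  fixes p :: "int \<Rightarrow> rat"
  assumes step: "\<And>n. p n < p (n + 1)"
    and above: "\<And>y. \<exists>n. y < p n" and below: "\<And>y. \<exists>n. p n \<le> y"
  obtains g where "g \<in> Aut" "\<And>n. g (of_int n) = p n"
proof -
  define g where "g x = p \<lfloor>x\<rfloor> + (x - of_int \<lfloor>x\<rfloor>) * (p (\<lfloor>x\<rfloor> + 1) - p \<lfloor>x\<rfloor>)" for x
  have mono: "p m \<le> p n" if "m \<le> n" for m n
    using that
  proof (induction n rule: int_ge_induct)
    case (step i)
    then show ?case using assms(1)[of i] by linarith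
  qed simp
  have "g \<in> Aut"
  proof (rule AutI)
    fix x y :: rat assume less: "x < y"
    show "g x < g y"
    proof (cases "\<lfloor>x\<rfloor> = \<lfloor>y\<rfloor>")
      case True
      then show ?thesis using less step[of "\<lfloor>y\<rfloor>"] by (simp add: g_def)
    next
      case False
      then have "\<lfloor>x\<rfloor> + 1 \<le> \<lfloor>y\<rfloor>" using floor_mono[of x y] less by linarith
      then have "p (\<lfloor>x\<rfloor> + 1) \<le> p \<lfloor>y\<rfloor>" by (rule mono)
      moreover have "x - of_int \<lfloor>x\<rfloor> < 1" by linarith
      then have "(x - of_int \<lfloor>x\<rfloor>) * (p (\<lfloor>x\<rfloor> + 1) - p \<lfloor>x\<rfloor>) < p (\<lfloor>x\<rfloor> + 1) - p \<lfloor>x\<rfloor>"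
        using step[of "\<lfloor>x\<rfloor>"] by simp
      moreover have "0 \<le> (y - of_int \<lfloor>y\<rfloor>) * (p (\<lfloor>y\<rfloor> + 1) - p \<lfloor>y\<rfloor>)"
        using step[of "\<lfloor>y\<rfloor>"] by (intro mult_nonneg_nonneg) (simp_all add: less_imp_le)
      ultimately show ?thesis by (simp add: g_def)
    qed
  next
    fix y
    obtain m N where m: "p m \<le> y" and N: "y < p N" using above below by meson
    \<comment> \<open>Otherwise \<open>p n \<le> y\<close> would propagate from \<open>m\<close> to
      all larger indices, contradicting the choice of \<open>N\<close>.\<close>
    have "\<exists>n. p n \<le> y \<and> y < p (n + 1)"
    proof (rule ccontr)
      assume *: "\<not> ?thesis"
      have "p n \<le> y" if "m \<le> n" for n
        using that by (induction n rule: int_ge_induct) (use m * in \<open>force simp: not_less\<close>)+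
      then have "N < m" using N by (meson leD le_less_linear)
      then show False using mono[of N m] m N by simp
    qed
    then obtain n where n: "p n \<le> y" "y < p (n + 1)" by blast
    define t where "t = (y - p n) / (p (n + 1) - p n)"
    have t: "0 \<le> t" "t < 1" "t * (p (n + 1) - p n) = y - p n"
      using n by (simp_all add: t_def)
    then have "\<lfloor>of_int n + t\<rfloor> = n" by (simp add: floor_eq_iff)
    then have "g (of_int n + t) = y" using t by (simp add: g_def)
    then show "\<exists>x. g x = y" by blast
  qed
  moreover have "g (of_int n) = p n" for n by (simp add: g_def)
  ultimately show ?thesis by (rule that)
qed

section \<open>Coding a family of automorphisms by a single one\<close>

text \<open>For an automorphism \<open>f\<close> this says that the images of \<open>S\<close> under
  the powers of \<open>f\<close>, which are the sets \<open>level f S n\<close>, are pairwise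
  disjoint.\<close>

definition wandering :: "(rat \<Rightarrow> rat) \<Rightarrow> rat set \<Rightarrow> bool" where
  "wandering f S \<longleftrightarrow> (\<forall>x\<in>S. \<forall>n. (f \<up> n) x \<in> S \<longrightarrow> n = 0)"

definition level :: "(rat \<Rightarrow> rat) \<Rightarrow> rat set \<Rightarrow> int \<Rightarrow> rat set" where
  "level f S n = {x. (f \<up> (- n)) x \<in> S}"

lemma level_disjoint:
  assumes f: "f \<in> Aut" and "wandering f S" and x: "x \<in> level f S m" "x \<in> level f S n"
  shows "m = n"
proof -
  have "(f \<up> (m - n)) ((f \<up> (- m)) x) = (f \<up> (- n)) x"
    using aut_pow_add[OF f, of "- m" "m - n" x] by simp
  then have "m - n = 0"
    using assms(2) x unfolding wandering_def level_def by (metis mem_Collect_eq)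
  then show ?thesis by simp
qed

lemma wandering_inv: "f \<in> Aut \<Longrightarrow> wandering f S \<Longrightarrow> wandering (f \<up> (-1)) S"
  unfolding wandering_def by (simp add: Aut.int_pow_pow) (metis neg_equal_0_iff_equal)

lemma level_conjugate:
  assumes f: "f \<in> Aut" and "supported g S"
  shows "supported (f \<up> (- n) \<bullet> g \<bullet> f \<up> n) (level f S n)"
  using assms aut_pow_minus[OF f, of "- n"] by (simp add: supported_def level_def)

lemma level_subset:
  assumes "f \<in> Aut" "supported f J" "S \<subseteq> J"
  shows "level f S n \<subseteq> J"
  using assms supported_mem_iff[OF Aut.int_pow_closed supported_int_pow] by (auto simp: level_def)

text \<open>The copies of \<open>inv D\<close> on the levels \<open>1, 2, \<dots>\<close> form \<open>y\<close>; conjugation by \<open>f\<close> shifts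
  them by one level, so that all of them cancel in the commutator except for one.\<close>

lemma commutator_swindle:
  assumes f: "f \<in> Aut" "supported f J" and D: "D \<in> Aut" "supported D S"
    and S: "S \<subseteq> J" "wandering f S"
  obtains y where "y \<in> Aut" "supported y J" "\<And>x. f (y x) = y (f (D x))"
proof -
  \<comment> \<open>Only the levels from 1 on carry a factor; the other sets are empty, so that the
    family can still be indexed by all integers.\<close>
  define L where "L n = (if n \<ge> 1 then level f S n else {})" for n
  define h where "h n = (if n \<ge> 1 then f \<up> (- n) \<bullet> aut_inv D \<bullet> f \<up> n else \<one>\<^bsub>Aut_rat\<^esub>)" for n
  define y where "y = disjoint_product L h"
  have disj: "m = n" if "x \<in> L m" "x \<in> L n" for m n x
    using that level_disjoint[OF f(1) S(2), of x m n] by (simp add: L_def split: if_splits)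
  have aut: "h n \<in> Aut" for n using f(1) D(1) by (simp add: h_def)
  have supp: "supported (h n) (L n)" for n
    using level_conjugate[OF f(1) supported_inv[OF D], of n] by (simp add: h_def L_def)
  have y_on: "y x = (f \<up> n) (aut_inv D ((f \<up> (- n)) x))" if "n \<ge> 1" "(f \<up> (- n)) x \<in> S" for x n
    using disjoint_product_apply[of L x n h, OF disj] that by (simp add: y_def L_def h_def level_def)
  have y_off: "y x = x" if "\<And>n. n \<ge> 1 \<Longrightarrow> (f \<up> (- n)) x \<notin> S" for x
    unfolding y_def by (rule disjoint_product_outside) (use that in \<open>simp add: L_def level_def\<close>)
  have "y \<in> Aut" unfolding y_def by (rule disjoint_product_aut[OF disj aut supp])
  moreover have "supported y J"
    unfolding supported_def
  proof (intro allI impI)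
    fix x assume "x \<notin> J"
    then show "y x = x"
      using level_subset[OF f S(1)] by (intro y_off) (auto simp: level_def)
  qed
  moreover have "f (y x) = y (f (D x))" for x
  proof -
    have shift: "(f \<up> (- (n + 1))) (f z) = (f \<up> (- n)) z" for n z
      using aut_pow_add[OF f(1), of 1 "- (n + 1)" z] f(1) by (simp add: Aut.int_pow_1)
    \<comment> \<open>On a level \<open>n \<ge> 1\<close> both sides end on level
      \<open>n + 1\<close> with the same value; on level 0 the copy of the inverse on level 1 undoes
      \<open>D\<close>; elsewhere \<open>D\<close> and \<open>y\<close> do nothing.\<close>
    consider n where "n \<ge> 1" "(f \<up> (- n)) x \<in> S" | "x \<in> S"
      | "\<And>n. n \<ge> 0 \<Longrightarrow> (f \<up> (- n)) x \<notin> S"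
      by (metis aut_pow_0 int_one_le_iff_zero_less less_le minus_zero)
    then show ?thesis
    proof cases
      case 1
      then have "x \<notin> S"
        using level_disjoint[OF f(1) S(2), of x n 0] by (auto simp: level_def)
      then have "D x = x" by (rule supportedD[OF D(2)])
      moreover have "y (f x) = (f \<up> (n + 1)) (aut_inv D ((f \<up> (- n)) x))"
        using y_on[of "n + 1" "f x"] 1 shift[of n x] by simp
      ultimately show ?thesis using y_on[OF 1] by (simp add: aut_pow_Suc f(1))
    next
      case 2
      then have "y x = x"
        using level_disjoint[OF f(1) S(2), of x _ 0] by (intro y_off) (force simp: level_def)
      moreover have "D x \<in> S" using 2 supported_mem_iff[OF D] by simp
      then have "y (f (D x)) = (f \<up> (0 + 1)) (aut_inv D (D x))"
        using y_on[of 1 "f (D x)"] shift[of 0 "D x"] by simp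
      ultimately show ?thesis using D(1) f(1) by (simp add: Aut.int_pow_1)
    next
      case 3
      then have "D x = x" using 3[of 0] supportedD[OF D(2), of x] by simp
      moreover have "y x = x" using 3 by (intro y_off) simp
      moreover have "y (f x) = f x"
      proof (rule y_off)
        fix n :: int assume "n \<ge> 1"
        then show "(f \<up> (- n)) (f x) \<notin> S" using 3[of "n - 1"] shift[of "n - 1" x] by simp
      qed
      ultimately show ?thesis by simp
    qed
  qed
  ultimately show ?thesis by (rule that)
qed

text \<open>The swindle writes each \<open>D k\<close> as a commutator of some \<open>y k\<close>
  supported in \<open>J\<close> with a power of \<open>x\<close>. As \<open>J\<close> wanders under
  \<open>c\<close>, a single \<open>e\<close> can carry all the \<open>y k\<close> on disjoint
  levels; conjugation by \<open>c \<up> k\<close> brings the \<open>k\<close>-th one back to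
  \<open>J\<close>, where \<open>x\<close> acts.\<close>

lemma code_family:
  fixes D :: "int \<Rightarrow> rat \<Rightarrow> rat" and \<epsilon> :: "int \<Rightarrow> int"
  assumes c: "c \<in> Aut" "supported c W" and x: "x \<in> Aut" "supported x J"
    and J: "J \<subseteq> W" "wandering c J" and S: "S \<subseteq> J" "wandering x S"
    and D: "\<And>k. D k \<in> Aut" "\<And>k. supported (D k) S" and \<epsilon>: "\<And>k. \<epsilon> k = 1 \<or> \<epsilon> k = -1"
  obtains e where "e \<in> Aut" "supported e W"
    "\<And>k. let A = c \<up> k \<bullet> e \<up> \<epsilon> k \<bullet> aut_inv (c \<up> k); X = x \<up> \<epsilon> k
      in A \<bullet> X \<bullet> aut_inv A \<bullet> aut_inv X = D k"
proof -
  have "\<exists>y. y \<in> Aut \<and> supported y J \<and> (\<forall>u. (x \<up> \<epsilon> k) (y u) = y ((x \<up> \<epsilon> k) (D k u)))" for k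
  proof -
    have "wandering (x \<up> \<epsilon> k) S"
      using \<epsilon>[of k] S(2) wandering_inv[OF x(1)] x(1) by (auto simp: Aut.int_pow_1)
    then show ?thesis
      using commutator_swindle[OF _ supported_int_pow[OF x] D(1,2) S(1)] x(1)
      by (metis Aut.int_pow_closed)
  qed
  then obtain y where y: "\<And>k. y k \<in> Aut" "\<And>k. supported (y k) J"
    "\<And>k u. (x \<up> \<epsilon> k) (y k u) = y k ((x \<up> \<epsilon> k) (D k u))" by metis
  \<comment> \<open>\<open>e\<close> enters the commutator with exponent
    \<open>\<epsilon> k\<close>, whose square is 1, so storing this power returns
    \<open>y k\<close>.\<close>
  define z where "z k = y k \<up> \<epsilon> k" for k
  define h where "h k = c \<up> (- k) \<bullet> z k \<bullet> c \<up> k" for k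
  define e where "e = disjoint_product (level c J) h"
  have z: "z k \<in> Aut" "supported (z k) J" for k
    using y supported_int_pow[OF y(1,2)] by (simp_all add: z_def)
  have disj: "\<And>i j u. u \<in> level c J i \<Longrightarrow> u \<in> level c J j \<Longrightarrow> i = j"
    by (rule level_disjoint[OF c(1) J(2)])
  have e: "e \<in> Aut"
    unfolding e_def
    by (rule disjoint_product_aut[OF disj]) (simp_all add: h_def c(1) z level_conjugate)
  moreover have "supported e W"
    unfolding supported_def e_def
    using level_subset[OF c J(1)] by (auto intro!: disjoint_product_outside)
  moreover have "let A = c \<up> k \<bullet> e \<up> \<epsilon> k \<bullet> aut_inv (c \<up> k); X = x \<up> \<epsilon> k
      in A \<bullet> X \<bullet> aut_inv A \<bullet> aut_inv X = D k" for k
  proof -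
    define A where "A = c \<up> k \<bullet> e \<up> \<epsilon> k \<bullet> aut_inv (c \<up> k)"
    define B where "B = c \<up> k \<bullet> e \<bullet> aut_inv (c \<up> k)"
    define X where "X = x \<up> \<epsilon> k"
    have aut: "A \<in> Aut" "B \<in> Aut" "X \<in> Aut" using c e x by (simp_all add: A_def B_def X_def)
    have B: "B u = z k u" if "u \<in> J" for u
    proof -
      have "(c \<up> k) u \<in> level c J k" using that by (simp add: level_def aut_pow_minus c)
      then have "e ((c \<up> k) u) = h k ((c \<up> k) u)"
        unfolding e_def by (intro disjoint_product_apply disj)
      also have "\<dots> = (c \<up> k) (z k u)"
        unfolding h_def mult_apply aut_pow_minus[OF c(1)] ..
      finally have "e ((c \<up> k) u) = (c \<up> k) (z k u)" .
      then show ?thesis using c by (simp add: B_def)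
    qed
    have A: "A u = y k u" if u: "u \<in> J" for u
      using \<epsilon>[of k]
    proof
      assume "\<epsilon> k = 1"
      then show ?thesis using B[OF u] e y by (simp add: A_def B_def z_def Aut.int_pow_1)
    next
      assume minus: "\<epsilon> k = -1"
      then have "A = aut_inv B"
        using c e by (simp add: A_def B_def Aut.int_pow_neg Aut.int_pow_1 Aut.inv_mult_group Aut.m_assoc)
      moreover have "y k u \<in> J" using u supported_mem_iff[OF y(1,2)] by simp
      then have "B (y k u) = u"
        using B minus y by (simp add: z_def Aut.int_pow_neg Aut.int_pow_1)
      ultimately show ?thesis using aut by (metis aut_inv_apply(2))
    qed
    have A_mem: "A u \<in> J \<longleftrightarrow> u \<in> J" for u
    proof
      assume *: "A u \<in> J"
      define v where "v = aut_inv (y k) (A u)"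
      have "v \<in> J" using * supported_mem_iff[OF _ supported_inv[OF y(1,2)]] y(1) by (simp add: v_def)
      moreover from this have "A v = A u" using A y(1) by (simp add: v_def)
      ultimately show "u \<in> J" using Aut_eq_iff[OF aut(1)] by simp
    qed (use A supported_mem_iff[OF y(1,2)] in simp)
    have suppX: "supported X J" unfolding X_def by (rule supported_int_pow[OF x])
    have DJ: "supported (D k) J" using D(2) S(1) by (rule supported_mono)
    \<comment> \<open>On \<open>J\<close> the map \<open>A\<close> agrees with \<open>y k\<close>,
      and this is the swindle identity. Off \<open>J\<close> it is enough that \<open>A\<close>
      preserves the complement, since \<open>X\<close> and \<open>D k\<close> are trivial
      there.\<close>
    have "A \<bullet> X = D k \<bullet> (X \<bullet> A)"
    proof
      fix u
      show "(A \<bullet> X) u = (D k \<bullet> (X \<bullet> A)) u"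
      proof (cases "u \<in> J")
        case True
        then have "X (D k u) \<in> J"
          using supported_mem_iff[OF aut(3) suppX] supported_mem_iff[OF D(1) DJ] by simp
        then show ?thesis using A True y(3)[of k u] by (simp add: X_def)
      next
        case False
        then have "A u \<notin> J" using A_mem by simp
        then show ?thesis using False supportedD[OF suppX] supportedD[OF DJ] by simp
      qed
    qed
    then have "A \<bullet> X \<bullet> aut_inv A \<bullet> aut_inv X = D k \<bullet> (X \<bullet> A) \<bullet> aut_inv A \<bullet> aut_inv X"
      by simp
    also have "\<dots> = D k"
      using aut by (simp add: fun_eq_iff)
    finally show ?thesis unfolding A_def X_def Let_def .
  qed
  ultimately show ?thesis by (rule that)
qed

section \<open>Bumps and wandering intervals\<close>

lemma bump_exists:
  fixes u v w z :: rat
  assumes "u < v" "v < w" "w < z"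
  obtains f where "f \<in> Aut" "supported f {u..<z}" "f v = w" "\<And>x. x \<le> f x"
proof -
  \<comment> \<open>The slopes of the lines through \<open>(u, u)\<close> and \<open>(v, w)\<close>,
    and through \<open>(v, w)\<close> and \<open>(z, z)\<close>. The minimum of the lines is a roof
    over the diagonal; the maximum with the identity cuts it off outside
    \<open>[u, z)\<close>.\<close>
  define \<alpha> where "\<alpha> = (w - u) / (v - u)"
  define \<beta> where "\<beta> = (z - w) / (z - v)"
  define f where "f x = max x (min (\<alpha> * x + (u - \<alpha> * u)) (\<beta> * x + (z - \<beta> * z)))" for x
  have "1 < \<alpha>" "0 < \<beta>" "\<beta> < 1" using assms by (simp_all add: \<alpha>_def \<beta>_def)
  have "\<alpha> * (v - u) = w - u" "\<beta> * (z - v) = z - w"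
    using assms by (simp_all add: \<alpha>_def \<beta>_def)
  then have "f v = w" using assms by (simp add: f_def algebra_simps)
  moreover have "f \<in> Aut"
    unfolding f_def using \<open>1 < \<alpha>\<close> \<open>0 < \<beta>\<close> affine_aut[of 1 0]
    by (intro aut_max aut_min affine_aut) simp_all
  moreover have "f x = x" if "x < u \<or> z \<le> x" for x
    using that
  proof
    assume "x < u"
    then have "(\<alpha> - 1) * (x - u) \<le> 0" using \<open>1 < \<alpha>\<close> by (simp add: mult_nonneg_nonpos)
    then show ?thesis by (simp add: f_def algebra_simps)
  next
    assume "z \<le> x"
    then have "(1 - \<beta>) * (z - x) \<le> 0" using \<open>\<beta> < 1\<close> by (simp add: mult_nonneg_nonpos)
    then show ?thesis by (simp add: f_def algebra_simps)
  qed
  then have "supported f {u..<z}" by (auto simp: supported_def)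
  moreover have "x \<le> f x" for x by (simp add: f_def)
  ultimately show ?thesis by (intro that)
qed

text \<open>No point moves down and \<open>v\<close> jumps at least to \<open>w\<close>, so positive
  powers push the interval off itself to the right; a negative power is treated by starting from the
  image point.\<close>

lemma wandering_interval:
  assumes f: "f \<in> Aut" and up: "\<And>x. x \<le> f x" and "w \<le> f v"
  shows "wandering f {v..<w}"
proof -
  have nat: "x \<le> (f \<up> int n) x" for n x
  proof (induction n)
    case (Suc n)
    then show ?case using up[of "(f \<up> int n) x"] aut_pow_Suc[OF f, of "int n" x]
      by (simp add: add.commute)
  qed simp
  have pos: "(f \<up> k) x \<notin> {v..<w}" if "k \<ge> 1" "x \<ge> v" for k x
  proof -
    have "f x \<le> (f \<up> int (nat (k - 1))) (f x)" by (rule nat)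
    also have "\<dots> = (f \<up> k) x"
      using that aut_pow_add[OF f, of 1 "k - 1" x] f by (simp add: Aut.int_pow_1)
    finally show ?thesis using assms that(2) Aut_le_iff[OF f, of v x] by simp
  qed
  show ?thesis
    unfolding wandering_def
  proof (intro ballI allI impI)
    fix x n assume x: "x \<in> {v..<w}" and fx: "(f \<up> n) x \<in> {v..<w}"
    consider "n \<ge> 1" | "n = 0" | "- n \<ge> 1" by linarith
    then show "n = 0"
      using pos[of n x] pos[of "- n" "(f \<up> n) x"] x fx aut_pow_minus[OF f, of n x]
      by cases simp_all
  qed
qed

section \<open>Coding a sequence of automorphisms by a pair satisfying the relation\<close>

definition shift :: "rat \<Rightarrow> rat" where
  "shift x = x + 1"

lemma shift_aut [simp]: "shift \<in> Aut"
  unfolding shift_def by (rule translation_aut)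

lemma shift_nat_pow: "(shift [^]\<^bsub>Aut_rat\<^esub> (n::nat)) x = x + of_nat n"
  by (induction n) (simp_all add: shift_def)

lemma shift_inv_nat_pow: "aut_inv (shift [^]\<^bsub>Aut_rat\<^esub> (n::nat)) x = x - of_nat n"
  using aut_inv_apply(2)[of "shift [^]\<^bsub>Aut_rat\<^esub> n" "x - of_nat n"]
  by (simp add: shift_nat_pow)

section \<open>Automorphisms acting separately on the cells \<open>[8n, 8n + 8)\<close>\<close>

definition cellwise :: "(int \<Rightarrow> rat \<Rightarrow> rat) \<Rightarrow> rat \<Rightarrow> rat" where
  "cellwise g x = (let n = \<lfloor>x / 8\<rfloor> in 8 * of_int n + g n (x - 8 * of_int n))"

definition cell_family :: "(int \<Rightarrow> rat \<Rightarrow> rat) \<Rightarrow> bool" where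
  "cell_family g \<longleftrightarrow> (\<forall>n. g n \<in> Aut \<and> supported (g n) {0..<8})"

lemma cell_familyD:
  assumes "cell_family g"
  shows "g n \<in> Aut" "supported (g n) {0..<8}"
  using assms by (simp_all add: cell_family_def)

lemma cell_cases:
  fixes x :: rat
  obtains n v where "x = 8 * of_int n + v" "v \<in> {0..<8}"
proof
  show "x = 8 * of_int \<lfloor>x / 8\<rfloor> + (x - 8 * of_int \<lfloor>x / 8\<rfloor>)" by simp
  show "x - 8 * of_int \<lfloor>x / 8\<rfloor> \<in> {0..<8}" by (simp, linarith)
qed

lemma cellwise_apply:
  assumes "v \<in> {0..<8}"
  shows "cellwise g (8 * of_int n + v) = 8 * of_int n + g n v"
proof -
  have "\<lfloor>(8 * of_int n + v) / 8\<rfloor> = n" using assms by (simp add: floor_eq_iff)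
  then show ?thesis by (simp add: cellwise_def)
qed

lemma cell_family_mem: "cell_family g \<Longrightarrow> v \<in> {0..<8} \<Longrightarrow> g n v \<in> {0..<8}"
  using supported_mem_iff[of "g n" "{0..<8}" v] cell_familyD[of g n] by simp

lemma cellwise_one: "cellwise (\<lambda>n. \<one>\<^bsub>Aut_rat\<^esub>) = \<one>\<^bsub>Aut_rat\<^esub>"
  by (simp add: fun_eq_iff cellwise_def Let_def)

lemma cellwise_mult:
  assumes "cell_family g"
  shows "cellwise g \<bullet> cellwise h = cellwise (\<lambda>n. g n \<bullet> h n)"
proof
  fix x :: rat
  obtain n v where "x = 8 * of_int n + v" "v \<in> {0..<8}" by (rule cell_cases)
  then show "(cellwise g \<bullet> cellwise h) x = cellwise (\<lambda>n. g n \<bullet> h n) x"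
    by (simp only: mult_apply cellwise_apply cell_family_mem[OF assms])
qed

lemma cell_family_mult: "cell_family g \<Longrightarrow> cell_family h \<Longrightarrow> cell_family (\<lambda>n. g n \<bullet> h n)"
  by (simp add: cell_family_def supported_mult)

lemma cell_family_inv: "cell_family g \<Longrightarrow> cell_family (\<lambda>n. aut_inv (g n))"
  by (simp add: cell_family_def supported_inv)

lemma cell_family_nat_pow: "cell_family g \<Longrightarrow> cell_family (\<lambda>n. g n [^]\<^bsub>Aut_rat\<^esub> (k::nat))"
  by (simp add: cell_family_def supported_nat_pow)

lemma cell_family_shift: "cell_family g \<Longrightarrow> cell_family (\<lambda>n. g (n + j))"
  by (simp add: cell_family_def)

lemma cellwise_aut:
  assumes g: "cell_family g"
  shows "cellwise g \<in> Aut"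
proof (rule AutI)
  fix x y :: rat assume less: "x < y"
  obtain n v where x: "x = 8 * of_int n + v" "v \<in> {0..<8}" by (rule cell_cases)
  obtain m w where y: "y = 8 * of_int m + w" "w \<in> {0..<8}" by (rule cell_cases)
  show "cellwise g x < cellwise g y"
  proof (cases "n = m")
    case True
    then show ?thesis
      unfolding x(1) y(1) using x y less cell_familyD(1)[OF g]
      by (simp add: cellwise_apply Aut_less_iff)
  next
    case False
    moreover have "n \<le> m"
    proof (rule ccontr)
      assume "\<not> n \<le> m"
      then have "of_int m + 1 \<le> (of_int n :: rat)" by linarith
      then show False using less x y by auto
    qed
    ultimately have "of_int n + 1 \<le> (of_int m :: rat)" by linarith
    then show ?thesis
      unfolding x(1) y(1) cellwise_apply[OF x(2)] cellwise_apply[OF y(2)]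
      using cell_family_mem[OF g x(2), of n] cell_family_mem[OF g y(2), of m] by simp
  qed
next
  fix y
  have "cellwise (\<lambda>n. aut_inv (g n)) \<bullet> cellwise g = cellwise (\<lambda>n. aut_inv (g n) \<bullet> g n)"
    by (intro cellwise_mult cell_family_inv g)
  also have "\<dots> = \<one>\<^bsub>Aut_rat\<^esub>"
    using cell_familyD(1)[OF g] by (simp add: cellwise_one)
  finally have "cellwise g (cellwise (\<lambda>n. aut_inv (g n)) y) = y"
    by (metis mult_apply one_apply)
  then show "\<exists>x. cellwise g x = y" by blast
qed

lemma cellwise_inv:
  assumes "cell_family g"
  shows "aut_inv (cellwise g) = cellwise (\<lambda>n. aut_inv (g n))"
proof (rule Aut.inv_equality)
  show "cellwise (\<lambda>n. aut_inv (g n)) \<bullet> cellwise g = \<one>\<^bsub>Aut_rat\<^esub>"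
    using assms by (simp add: cellwise_mult cell_family_inv cell_familyD cellwise_one)
qed (simp_all add: cellwise_aut cell_family_inv assms)

lemma cellwise_nat_pow:
  assumes "cell_family g"
  shows "cellwise g [^]\<^bsub>Aut_rat\<^esub> (k::nat) = cellwise (\<lambda>n. g n [^]\<^bsub>Aut_rat\<^esub> k)"
  by (induction k)
    (simp_all only: Aut.nat_pow_0 Aut.nat_pow_Suc cellwise_one cellwise_mult cell_family_nat_pow assms)

lemma cellwise_shift:
  assumes "cell_family g"
  shows "shift [^]\<^bsub>Aut_rat\<^esub> (8 * j :: nat) \<bullet> cellwise g \<bullet> aut_inv (shift [^]\<^bsub>Aut_rat\<^esub> (8 * j))
    = cellwise (\<lambda>n. g (n + int j))"
proof
  fix x :: rat
  obtain n v where x: "x = 8 * of_int n + v" and v: "v \<in> {0..<8}" by (rule cell_cases)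
  have "x + of_nat (8 * j) = 8 * of_int (n + int j) + v" by (simp add: x)
  then show "(shift [^]\<^bsub>Aut_rat\<^esub> (8 * j) \<bullet> cellwise g \<bullet> aut_inv (shift [^]\<^bsub>Aut_rat\<^esub> (8 * j))) x
    = cellwise (\<lambda>n. g (n + int j)) x"
    unfolding mult_apply shift_nat_pow shift_inv_nat_pow x
    by (simp only: cellwise_apply[OF v])
qed

text \<open>With \<open>b = inv (a ^ 40) X\<close>, the first line recovers \<open>X\<close>;
  \<open>Y\<close> and \<open>Z\<close> are \<open>X\<close> read one and four cells further on. The
  group is arbitrary because the formula is both expressed by a positive word and computed in
  \<open>Aut_rat\<close>.\<close>

definition decode :: "('g, 'c) monoid_scheme \<Rightarrow> nat \<Rightarrow> 'g \<Rightarrow> 'g \<Rightarrow> 'g" where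
  "decode G i a b = (let
     X = a [^]\<^bsub>G\<^esub> (40::nat) \<otimes>\<^bsub>G\<^esub> b;
     R = X [^]\<^bsub>G\<^esub> ((2::nat) ^ i);
     Y = a [^]\<^bsub>G\<^esub> (8::nat) \<otimes>\<^bsub>G\<^esub> X \<otimes>\<^bsub>G\<^esub> inv\<^bsub>G\<^esub> (a [^]\<^bsub>G\<^esub> (8::nat));
     Z = a [^]\<^bsub>G\<^esub> (32::nat) \<otimes>\<^bsub>G\<^esub> X \<otimes>\<^bsub>G\<^esub> inv\<^bsub>G\<^esub> (a [^]\<^bsub>G\<^esub> (32::nat));
     A = R \<otimes>\<^bsub>G\<^esub> Y \<otimes>\<^bsub>G\<^esub> inv\<^bsub>G\<^esub> R
   in A \<otimes>\<^bsub>G\<^esub> Z \<otimes>\<^bsub>G\<^esub> inv\<^bsub>G\<^esub> A \<otimes>\<^bsub>G\<^esub> inv\<^bsub>G\<^esub> Z)"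

text \<open>The power \<open>(-1) ^ q\<close>, also for negative \<open>q\<close>.\<close>

definition alternating_sign :: "int \<Rightarrow> int" where
  "alternating_sign q = (if even q then 1 else -1)"

text \<open>In the \<open>q\<close>-th period \<open>decode G i\<close> reads off the level \<open>code_index (i, q)\<close>. The levels are
  distinct: \<open>i\<close> is recovered as a 2-adic valuation, \<open>q\<close> from the odd part.\<close>

definition code_index :: "nat \<times> int \<Rightarrow> int" where
  "code_index = (\<lambda>(i, q). alternating_sign q * (4 * q + 1) * 2 ^ i)"

lemma odd_times_power2_eq:
  fixes u v :: int
  assumes "odd u" "odd v" "u * 2 ^ i = v * 2 ^ j"
  shows "i = j \<and> u = v"
proof -
  have *: "i = j" if "odd u" "u * 2 ^ i = v * 2 ^ j" "i \<le> j" for u v :: int and i j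
  proof (rule ccontr)
    assume "i \<noteq> j"
    then have "j = i + Suc (j - i - 1)" using that(3) by simp
    then obtain k where "j = i + Suc k" ..
    then have "u = v * 2 ^ Suc k" using that(2) by (simp add: power_add mult_ac)
    then show False using that(1) by simp
  qed
  have "i = j" using *[of u i v j] *[of v j u i] assms by (cases "i \<le> j") simp_all
  then show ?thesis using assms by simp
qed

lemma inj_code_index: "inj code_index"
proof (rule injI)
  fix s t assume eq: "code_index s = code_index t"
  obtain i q j r where st: "s = (i, q)" "t = (j, r)" by (metis surj_pair)
  have "i = j \<and> alternating_sign q * (4 * q + 1) = alternating_sign r * (4 * r + 1)"
    using eq by (intro odd_times_power2_eq) (simp_all add: st code_index_def alternating_sign_def)
  \<comment> \<open>Modulo 4 the odd part is 1 for an even period and 3 for an odd one, so the two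
    signs agree.\<close>
  moreover from this have "q = r"
    by (auto simp: alternating_sign_def split: if_splits) presburger+
  ultimately show "s = t" by (simp add: st)
qed

text \<open>On the cell \<open>5 * q\<close> the power of \<open>X\<close> with exponent
  \<open>2 ^ i\<close> acts as \<open>c\<close> with exponent \<open>code_index (i, q)\<close>.
  These exponents are distinct, so \<open>code_family\<close> stores all \<open>D i q\<close> in one
  \<open>e\<close>, and the commutator in \<open>decode\<close> retrieves them.\<close>

theorem code_sequence:
  assumes D: "\<And>i q. D i q \<in> Aut" "\<And>i q. supported (D i q) {2..<6}"
  obtains b where "related Aut_rat 40 shift b"
    "\<And>i. decode Aut_rat i shift b = cellwise (\<lambda>n. if n mod 5 = 0 then D i (n div 5) else \<one>\<^bsub>Aut_rat\<^esub>)"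
proof -
  \<comment> \<open>Carrying 1 to 7 makes \<open>[1, 7)\<close> wander under \<open>c\<close> inside
    \<open>[0, 8)\<close>; carrying 2 to 6 makes \<open>[2, 6)\<close> wander under \<open>x\<close>
    inside \<open>[1, 7)\<close>.\<close>
  obtain c where c: "c \<in> Aut" "supported c {0..<8}" and c1: "c 1 = 7" and c_up: "\<And>x. x \<le> c x"
    using bump_exists[of 0 1 7 8] by auto
  obtain x where x: "x \<in> Aut" "supported x {1..<7}" and x2: "x 2 = 6" and x_up: "\<And>u. u \<le> x u"
    using bump_exists[of 1 2 6 7] by auto
  have wc: "wandering c {1..<7}" and wx: "wandering x {2..<6}"
    using c1 x2 by (simp_all add: wandering_interval c x c_up x_up)
  have dec: "inv_into UNIV code_index (code_index s) = s" for s
    by (simp add: inj_code_index)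
  \<comment> \<open>Off the range of \<open>code_index\<close> the inverse returns some pair, and
    \<open>D'\<close> is still a member of the family, as \<open>code_family\<close> requires for
    every integer.\<close>
  define D' where "D' k = case_prod D (inv_into UNIV code_index k)" for k
  define \<epsilon> where "\<epsilon> k = alternating_sign (snd (inv_into UNIV code_index k))" for k
  obtain e where e: "e \<in> Aut" "supported e {0..<8}"
    and code: "\<And>k. let A = c \<up> k \<bullet> e \<up> \<epsilon> k \<bullet> aut_inv (c \<up> k); X = x \<up> \<epsilon> k
      in A \<bullet> X \<bullet> aut_inv A \<bullet> aut_inv X = D' k"
  proof (rule code_family[OF c x _ wc _ wx, of D' \<epsilon>])
    show "D' k \<in> Aut" "supported (D' k) {2..<6}" for k
      using D by (simp_all add: D'_def case_prod_beta)
    show "\<epsilon> k = 1 \<or> \<epsilon> k = -1" for k by (simp add: \<epsilon>_def alternating_sign_def)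
  qed auto
  \<comment> \<open>The exponents in \<open>expo\<close> are alternating signs times a polynomial of degree at most 1 in the
    period, so they are annihilated by \<open>(1 + s)^2\<close> for the shift \<open>s\<close>: this is the relation.
    The residues \<open>0, 1, 4\<close> modulo 5 are chosen such that their translates by \<open>-1\<close> and by \<open>-4\<close> meet
    only in \<open>0\<close>; hence the commutator in \<open>decode\<close> vanishes on the other cells.\<close>
  define base where "base n = (if n mod 5 = 0 then c else if n mod 5 = 1 then e
     else if n mod 5 = 4 then x else \<one>\<^bsub>Aut_rat\<^esub>)" for n :: int
  define expo where "expo n = alternating_sign (n div 5) * (if n mod 5 = 0 then 4 * (n div 5) + 1 else 1)"
    for n :: int
  define \<xi> where "\<xi> n = base n \<up> expo n" for n
  define X where "X = cellwise \<xi>"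
  \<comment> \<open>The 40 is one period of five cells of length 8.\<close>
  define b where "b = aut_inv (shift [^]\<^bsub>Aut_rat\<^esub> (40::nat)) \<bullet> X"
  have base: "base n \<in> Aut" "supported (base n) {0..<8}" for n
    using c e x by (auto simp: base_def elim: supported_mono)
  have period: "(n + 5) mod 5 = n mod 5" "(n + 10) mod 5 = n mod 5"
    "(n + 5) div 5 = n div 5 + 1" "(n + 10) div 5 = n div 5 + 2" for n :: int
    by presburger+
  have base_periodic: "base (n + 5) = base n" "base (n + 10) = base n" for n
    unfolding base_def period by simp_all
  have \<xi>: "cell_family \<xi>"
    using base by (simp add: cell_family_def \<xi>_def supported_int_pow)
  have X: "X \<in> Aut" unfolding X_def by (rule cellwise_aut[OF \<xi>])
  have b: "b \<in> Aut" using X by (simp add: b_def)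
  have "related Aut_rat 40 shift b"
    unfolding related_def
  proof (intro conjI)
    show "shift [^]\<^bsub>Aut_rat\<^esub> (3 * 40 :: nat) \<bullet>
        (b \<bullet> b \<bullet> shift [^]\<^bsub>Aut_rat\<^esub> (40::nat) \<bullet> b \<bullet> b) = \<one>\<^bsub>Aut_rat\<^esub>"
    proof
      fix y :: rat
      obtain n v where y: "y = 8 * of_int n + v" and v: "v \<in> {0..<8}" by (rule cell_cases)
      have b_apply: "b (8 * of_int m + w) = 8 * of_int (m - 5) + \<xi> (m - 5) w" if "w \<in> {0..<8}" for m w
      proof -
        have "8 * of_int m + w - of_nat 40 = 8 * of_int (m - 5) + w" by simp
        then show ?thesis
          unfolding b_def mult_apply shift_inv_nat_pow X_def by (simp only: cellwise_apply[OF that])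
      qed
      have up: "8 * of_int m + w + of_nat 40 = 8 * of_int (m + 5) + w"
        "8 * of_int m + w + of_nat (3 * 40) = 8 * of_int (m + 15) + w" for m and w :: rat by simp_all
      \<comment> \<open>The cells visited are \<open>n + 15\<close>, \<open>n + 10\<close>,
        \<open>n + 5\<close>, \<open>n + 10\<close>, \<open>n + 5\<close>, \<open>n\<close>; each
        \<open>b\<close> acts in the cell where it arrives.\<close>
      have "(shift [^]\<^bsub>Aut_rat\<^esub> (3 * 40 :: nat) \<bullet>
          (b \<bullet> b \<bullet> shift [^]\<^bsub>Aut_rat\<^esub> (40::nat) \<bullet> b \<bullet> b)) y
        = 8 * of_int n + \<xi> n (\<xi> (n + 5) (\<xi> (n + 5) (\<xi> (n + 10) v)))"
        unfolding mult_apply shift_nat_pow y up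
        by (simp only: b_apply up cell_family_mem[OF \<xi>] v) (simp add: add.commute)
      also have "\<xi> n (\<xi> (n + 5) (\<xi> (n + 5) (\<xi> (n + 10) v)))
        = (base n \<up> (expo (n + 10) + expo (n + 5) + expo (n + 5) + expo n)) v"
        unfolding \<xi>_def base_periodic by (simp only: aut_pow_add[OF base(1)])
      also have "expo (n + 10) + expo (n + 5) + expo (n + 5) + expo n = 0"
        unfolding expo_def period by (simp add: alternating_sign_def)
      finally show "(shift [^]\<^bsub>Aut_rat\<^esub> (3 * 40 :: nat) \<bullet>
          (b \<bullet> b \<bullet> shift [^]\<^bsub>Aut_rat\<^esub> (40::nat) \<bullet> b \<bullet> b)) y = \<one>\<^bsub>Aut_rat\<^esub> y"
        by (simp add: y)
    qed
  qed (simp_all add: b)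
  moreover have "decode Aut_rat i shift b
      = cellwise (\<lambda>n. if n mod 5 = 0 then D i (n div 5) else \<one>\<^bsub>Aut_rat\<^esub>)" for i
  proof -
    define R where "R n = \<xi> n [^]\<^bsub>Aut_rat\<^esub> ((2::nat) ^ i)" for n
    define A where "A n = R n \<bullet> \<xi> (n + 1) \<bullet> aut_inv (R n)" for n
    have X_b: "shift [^]\<^bsub>Aut_rat\<^esub> (40::nat) \<bullet> b = X"
      using X by (simp add: b_def fun_eq_iff)
    have fam: "cell_family R" "cell_family A" "cell_family (\<lambda>n. \<xi> (n + j))" for j
      using \<xi> unfolding A_def R_def
      by (intro cell_family_mult cell_family_inv cell_family_shift cell_family_nat_pow; assumption)+
    have Y: "shift [^]\<^bsub>Aut_rat\<^esub> (8::nat) \<bullet> X \<bullet> aut_inv (shift [^]\<^bsub>Aut_rat\<^esub> (8::nat))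
        = cellwise (\<lambda>n. \<xi> (n + 1))"
      using cellwise_shift[OF \<xi>, of 1] by (simp add: X_def)
    have Z: "shift [^]\<^bsub>Aut_rat\<^esub> (32::nat) \<bullet> X \<bullet> aut_inv (shift [^]\<^bsub>Aut_rat\<^esub> (32::nat))
        = cellwise (\<lambda>n. \<xi> (n + 4))"
      using cellwise_shift[OF \<xi>, of 4] by (simp add: X_def)
    have R: "X [^]\<^bsub>Aut_rat\<^esub> ((2::nat) ^ i) = cellwise R"
      unfolding X_def R_def by (rule cellwise_nat_pow[OF \<xi>])
    have "decode Aut_rat i shift b
        = cellwise (\<lambda>n. A n \<bullet> \<xi> (n + 4) \<bullet> aut_inv (A n) \<bullet> aut_inv (\<xi> (n + 4)))"
      unfolding decode_def Let_def X_b Y Z R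
      by (simp only: cellwise_inv cellwise_mult cell_family_mult cell_family_inv fam
          flip: A_def)
    also have "(\<lambda>n. A n \<bullet> \<xi> (n + 4) \<bullet> aut_inv (A n) \<bullet> aut_inv (\<xi> (n + 4)))
        = (\<lambda>n. if n mod 5 = 0 then D i (n div 5) else \<one>\<^bsub>Aut_rat\<^esub>)"
    proof
      fix n :: int
      show "A n \<bullet> \<xi> (n + 4) \<bullet> aut_inv (A n) \<bullet> aut_inv (\<xi> (n + 4))
        = (if n mod 5 = 0 then D i (n div 5) else \<one>\<^bsub>Aut_rat\<^esub>)"
      proof (cases "n mod 5 = 0")
        case True
        define q where "q = n div 5"
        then have n: "n = 5 * q" using True by auto
        define k where "k = code_index (i, q)"
        have "R n = c \<up> k"
          using c by (simp add: R_def \<xi>_def n base_def expo_def k_def code_index_def Aut.int_pow_pow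
              flip: int_pow_int)
        moreover have "\<xi> (n + 1) = e \<up> \<epsilon> k" "\<xi> (n + 4) = x \<up> \<epsilon> k"
          by (simp_all add: \<xi>_def n base_def expo_def \<epsilon>_def k_def dec)
        moreover have "D' k = D i q" by (simp add: D'_def k_def dec)
        ultimately show ?thesis
          using code[of k] True by (simp add: Let_def A_def q_def)
      next
        case False
        then have "n mod 5 = 1 \<or> n mod 5 = 2 \<or> n mod 5 = 3 \<or> n mod 5 = 4" by presburger
        then have "(n + 1) mod 5 \<notin> {0, 1, 4} \<or> (n + 4) mod 5 \<notin> {0, 1, 4}"
          by (simp, presburger)
        then have "\<xi> (n + 1) = \<one>\<^bsub>Aut_rat\<^esub> \<or> \<xi> (n + 4) = \<one>\<^bsub>Aut_rat\<^esub>"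
          by (auto simp: \<xi>_def base_def Aut.int_pow_one)
        then show ?thesis
        proof
          assume "\<xi> (n + 1) = \<one>\<^bsub>Aut_rat\<^esub>"
          then have "A n = \<one>\<^bsub>Aut_rat\<^esub>"
            using cell_familyD(1)[OF fam(1), of n] by (simp add: A_def)
          then show ?thesis using False cell_familyD(1)[OF \<xi>, of "n + 4"] by simp
        next
          assume "\<xi> (n + 4) = \<one>\<^bsub>Aut_rat\<^esub>"
          then show ?thesis using False cell_familyD(1)[OF fam(2), of n] by simp
        qed
      qed
    qed
    finally show ?thesis .
  qed
  ultimately show ?thesis by (rule that)
qed

section \<open>Fragmentation\<close>

lemma restrict_aut:
  assumes g: "g \<in> Aut" and S: "\<And>x. g x \<in> S \<longleftrightarrow> x \<in> S"
    and order: "\<And>x y. x \<in> S \<Longrightarrow> y \<notin> S \<Longrightarrow> x < y \<longleftrightarrow> g x < y"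
  shows "(\<lambda>x. if x \<in> S then g x else x) \<in> Aut"
proof (rule AutI)
  fix x y :: rat assume "x < y"
  moreover have "x < g y" if "x \<notin> S" "y \<in> S"
  proof -
    have "x \<noteq> g y" using that S[of y] by auto
    then show ?thesis using order[OF that(2,1)] \<open>x < y\<close> by (meson less_asym linorder_less_linear)
  qed
  ultimately show "(if x \<in> S then g x else x) < (if y \<in> S then g y else y)"
    using order[of x y] Aut_less_iff[OF g, of x y] by simp
next
  fix y
  show "\<exists>x. (if x \<in> S then g x else x) = y"
  proof (cases "y \<in> S")
    case True
    then have "aut_inv g y \<in> S" using S[of "aut_inv g y"] g by simp
    then show ?thesis using g by (intro exI[of _ "aut_inv g y"]) simp
  qed auto
qed

text \<open>\<open>strip 2\<close> consists of the parts \<open>[2, 6)\<close> of the cells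
  \<open>5q\<close>, where \<open>code_sequence\<close> places its data; the other strips are
  translates of it.\<close>

definition strip :: "int \<Rightarrow> rat set" where
  "strip l = {x. \<exists>q::int. 40 * of_int q + of_int l \<le> x \<and> x < 40 * of_int q + of_int l + 4}"

text \<open>The list of strips determines the word, so it must be fixed independently of the
  automorphism.\<close>

fun fragmented :: "int list \<Rightarrow> (rat \<Rightarrow> rat) set" where
  "fragmented [] = {\<one>\<^bsub>Aut_rat\<^esub>}"
| "fragmented (l # ls) = {k \<bullet> g |k g. k \<in> Aut \<and> supported k (strip l) \<and> g \<in> fragmented ls}"

lemma fragmented_closed: "g \<in> fragmented ls \<Longrightarrow> g \<in> Aut"
  by (induction ls arbitrary: g) auto

lemma fragmented_append:
  "f \<in> fragmented ls \<Longrightarrow> g \<in> fragmented ls' \<Longrightarrow> f \<bullet> g \<in> fragmented (ls @ ls')"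
proof (induction ls arbitrary: f)
  case Nil
  then show ?case using fragmented_closed[of g ls'] by simp
next
  case (Cons l ls)
  then obtain k h where f: "f = k \<bullet> h" and k: "k \<in> Aut" "supported k (strip l)"
    and h: "h \<in> fragmented ls" by auto
  have "f \<bullet> g = k \<bullet> (h \<bullet> g)"
    unfolding f using k h Cons.prems fragmented_closed by (intro Aut.m_assoc) auto
  then show ?case
    using k Cons.IH[OF h Cons.prems(2)] unfolding append_Cons fragmented.simps by blast
qed

text \<open>\<open>g\<close> preserves each interval between neighbouring grid points. Ten intervals
  of length 4 make up the period 40, so those of one residue modulo 10 form a strip; the induction
  splits off the highest remaining residue.\<close>

lemma fragmented_fixing_grid:
  fixes r :: int
  assumes "g \<in> Aut" "\<And>n::int. g (4 * of_int n + of_int r) = 4 * of_int n + of_int r"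
    "\<And>x. g x \<noteq> x \<Longrightarrow> \<lfloor>(x - of_int r) / 4\<rfloor> mod 10 < int m"
  shows "g \<in> fragmented (map (\<lambda>j. 4 * int j + r) (rev [0..<m]))"
  using assms
proof (induction m arbitrary: g)
  case 0
  have "g x = x" for x
  proof (rule ccontr)
    assume "g x \<noteq> x"
    then have "\<lfloor>(x - of_int r) / 4\<rfloor> mod 10 < int 0" by (rule 0)
    then show False by simp
  qed
  then show ?case by (simp add: fun_eq_iff)
next
  case (Suc m)
  note g = Suc.prems(1) and fixed = Suc.prems(2)
  define z where "z x = \<lfloor>(x - of_int r) / 4\<rfloor>" for x :: rat
  have z_eq: "z x = n \<longleftrightarrow> 4 * of_int n + of_int r \<le> x \<and> x < 4 * of_int (n + 1) + of_int r" for x n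
    by (auto simp: z_def floor_eq_iff field_simps)
  have z_mono: "x \<le> y \<Longrightarrow> z x \<le> z y" for x y
    unfolding z_def by (intro floor_mono) (simp add: divide_right_mono)
  have zg: "z (g x) = z x" for x
    using z_eq[of x "z x"] fixed[of "z x"] fixed[of "z x + 1"]
      Aut_le_iff[OF g, of "4 * of_int (z x) + of_int r" x]
      Aut_less_iff[OF g, of x "4 * of_int (z x + 1) + of_int r"]
    by (subst z_eq) simp
  define S where "S = {x. z x mod 10 = int m}"
  define k where "k = (\<lambda>x. if x \<in> S then g x else x)"
  have "k \<in> Aut"
    unfolding k_def
  proof (rule restrict_aut[OF g])
    show "g x \<in> S \<longleftrightarrow> x \<in> S" for x by (simp add: S_def zg)
    show "x < y \<longleftrightarrow> g x < y" if "x \<in> S" "y \<notin> S" for x y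
    proof -
      have "z x \<noteq> z y" using that by (auto simp: S_def)
      then show ?thesis
        using z_mono[of x y] z_mono[of y x] z_mono[of "g x" y] z_mono[of y "g x"] zg[of x] by linarith
    qed
  qed
  moreover have "supported k (strip (4 * int m + r))"
    unfolding supported_def
  proof (intro allI impI)
    fix x assume x: "x \<notin> strip (4 * int m + r)"
    have "x \<notin> S"
    proof
      assume "x \<in> S"
      then have "z x = 10 * (z x div 10) + int m"
        using div_mult_mod_eq[of "z x" 10] by (simp add: S_def)
      then obtain q where "z x = 10 * q + int m" ..
      then have "40 * of_int q + of_int (4 * int m + r) \<le> x \<and> x < 40 * of_int q + of_int (4 * int m + r) + 4"
        using z_eq[of x "10 * q + int m"] by (simp add: algebra_simps)
      then show False using x by (auto simp: strip_def)
    qed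
    then show "k x = x" by (simp add: k_def)
  qed
  moreover have "aut_inv k \<bullet> g \<in> fragmented (map (\<lambda>j. 4 * int j + r) (rev [0..<m]))"
  proof (rule Suc.IH)
    have outside: "aut_inv k x = x" if "x \<notin> S" for x
      using that aut_inv_apply(2)[OF \<open>k \<in> Aut\<close>, of x] by (simp add: k_def)
    show "aut_inv k \<bullet> g \<in> Aut" using \<open>k \<in> Aut\<close> g by simp
    have k_inv: "(aut_inv k \<bullet> g) x = (if x \<in> S then x else g x)" for x
    proof (cases "x \<in> S")
      case True
      have "supported k S" by (simp add: supported_def k_def)
      then have "aut_inv k x \<in> S"
        using supported_mem_iff[OF \<open>k \<in> Aut\<close>, of S "aut_inv k x"] True \<open>k \<in> Aut\<close> by simp
      then have "g (aut_inv k x) = k (aut_inv k x)" by (simp add: k_def)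
      then show ?thesis using True \<open>k \<in> Aut\<close> by simp
    qed (simp add: outside)
    show "(aut_inv k \<bullet> g) (4 * of_int n + of_int r) = 4 * of_int n + of_int r" for n
      unfolding k_inv by (simp add: fixed)
    show "\<lfloor>(x - of_int r) / 4\<rfloor> mod 10 < int m" if "(aut_inv k \<bullet> g) x \<noteq> x" for x
    proof -
      have "x \<notin> S" "g x \<noteq> x" using that unfolding k_inv by (auto split: if_splits)
      then show ?thesis using Suc.prems(3)[of x] by (simp add: S_def z_def)
    qed
  qed
  moreover have "g = k \<bullet> (aut_inv k \<bullet> g)"
    using \<open>k \<in> Aut\<close> by (simp add: fun_eq_iff)
  ultimately show ?case by auto
qed

section \<open>Automorphisms of bounded displacement\<close>

definition unit_pattern :: "int list" where
  "unit_pattern = map (\<lambda>j. 4 * int j + 2) (rev [0..<10]) @ map (\<lambda>j. 4 * int j + 0) (rev [0..<10])"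

text \<open>As \<open>h\<close> moves \<open>4n + 2\<close> by at most 1, some \<open>g\<close>
  agrees with \<open>h\<close> at these points and fixes all \<open>4n\<close>. Then
  \<open>h \<bullet> aut_inv g\<close> fixes the first grid and \<open>g\<close> the second, which
  gives the two halves of \<open>unit_pattern\<close>.\<close>

lemma fragmented_unit_displacement:
  assumes h: "h \<in> Aut" and close: "\<And>x. \<bar>h x - x\<bar> \<le> 1"
  shows "h \<in> fragmented unit_pattern"
proof -
  define p where "p n = (if even n then 2 * of_int n else h (2 * of_int n))" for n :: int
  have p_close: "\<bar>p n - 2 * of_int n\<bar> \<le> (if even n then 0 else 1)" for n
    using close by (simp add: p_def)
  obtain G where G: "G \<in> Aut" "\<And>n. G (of_int n) = p n"
  proof (rule piecewise_linear_aut[of p])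
    show "p n < p (n + 1)" for n
      using p_close[of n] p_close[of "n + 1"] by (cases "even n") (auto simp: abs_le_iff)
    have lower: "2 * of_int n - 1 \<le> p n" and upper: "p n \<le> 2 * of_int n + 1" for n
      using p_close[of n] by (auto simp: abs_le_iff split: if_splits)
    fix y :: rat
    obtain m :: int where m: "0 \<le> m" "\<bar>y\<bar> \<le> of_int m"
      using ex_le_of_int[of "\<bar>y\<bar>"] by (meson abs_ge_zero of_int_0_le_iff order_trans)
    have "y \<le> of_int m" "- of_int m \<le> y" "(0::rat) \<le> of_int m" using m by auto
    then have "y < p (m + 1)" "p (- m - 1) \<le> y"
      using lower[of "m + 1"] upper[of "- m - 1"] by simp_all
    then show "\<exists>n. y < p n" "\<exists>n. p n \<le> y" by blast+
  qed (rule that)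
  define g where "g x = G (1 / 2 * x)" for x
  have "g = (\<lambda>x. 1 / 2 * x + 0) \<bullet> G" by (simp add: g_def fun_eq_iff)
  then have g: "g \<in> Aut" using affine_aut[of "1 / 2" 0] G(1) by (simp del: mult_apply)
  have g_even: "g (4 * of_int n) = 4 * of_int n" for n
    using G(2)[of "2 * n"] by (simp add: g_def p_def)
  have g_odd: "g (4 * of_int n + 2) = h (4 * of_int n + 2)" for n
    using G(2)[of "2 * n + 1"] by (simp add: g_def p_def algebra_simps)
  have "h \<bullet> aut_inv g \<in> fragmented (map (\<lambda>j. 4 * int j + 2) (rev [0..<10]))"
  proof (rule fragmented_fixing_grid)
    show "(h \<bullet> aut_inv g) (4 * of_int n + of_int 2) = 4 * of_int n + of_int 2" for n
      using aut_inv_apply(2)[OF g, of "4 * of_int n + 2"] by (simp add: g_odd)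
  qed (use h g in simp_all)
  moreover have "g \<in> fragmented (map (\<lambda>j. 4 * int j + 0) (rev [0..<10]))"
    by (rule fragmented_fixing_grid) (simp_all add: g g_even)
  ultimately have "h \<bullet> aut_inv g \<bullet> g \<in> fragmented unit_pattern"
    unfolding unit_pattern_def by (rule fragmented_append)
  moreover have "h \<bullet> aut_inv g \<bullet> g = h" using g by (simp add: fun_eq_iff)
  ultimately show ?thesis by simp
qed

lemma fragmented_bounded_displacement:
  assumes "f \<in> Aut" "\<And>x. \<bar>f x - x\<bar> \<le> of_nat m"
  shows "f \<in> fragmented (concat (replicate m unit_pattern))"
  using assms
proof (induction m arbitrary: f)
  case 0
  then show ?case by (simp add: fun_eq_iff)
next
  case (Suc m)
  note f = Suc.prems(1)
  \<comment> \<open>Clamping the inverse of \<open>f\<close>: applied after \<open>f\<close>, it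
    moves \<open>f x\<close> back towards \<open>x\<close> by at most 1 and so removes one unit of
    displacement.\<close>
  define h where "h y = max (y + - 1) (min (y + 1) (aut_inv f y))" for y
  have h: "h \<in> Aut"
    unfolding h_def using f by (intro aut_max aut_min translation_aut) simp
  have "f \<bullet> h \<in> fragmented (concat (replicate m unit_pattern))"
  proof (rule Suc.IH)
    show "\<bar>(f \<bullet> h) x - x\<bar> \<le> of_nat m" for x
      using Suc.prems(2)[of x] f by (auto simp: h_def abs_le_iff max_def min_def)
  qed (use f h in \<open>simp del: mult_apply\<close>)
  moreover have "aut_inv h \<in> fragmented unit_pattern"
  proof (rule fragmented_unit_displacement)
    have "\<bar>h y - y\<bar> \<le> 1" for y by (auto simp: h_def abs_le_iff max_def min_def)
    from this[of "aut_inv h x" for x] show "\<bar>aut_inv h x - x\<bar> \<le> 1" for x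
      using h by (simp add: abs_minus_commute)
  qed (use h in simp)
  ultimately have "f \<bullet> h \<bullet> aut_inv h \<in> fragmented (concat (replicate m unit_pattern) @ unit_pattern)"
    by (rule fragmented_append)
  moreover have "f \<bullet> h \<bullet> aut_inv h = f" using h by (simp add: fun_eq_iff)
  moreover have "concat (replicate m xs) @ xs = concat (replicate (Suc m) xs)" for xs :: "int list"
    by (induction m) simp_all
  ultimately show ?case by simp
qed

section \<open>From strips to cells\<close>

lemma strip_cell:
  assumes v: "v \<in> {0..<8}"
  shows "8 * of_int n + v \<in> strip 2 \<longleftrightarrow> n mod 5 = 0 \<and> v \<in> {2..<6}"
proof
  assume "8 * of_int n + v \<in> strip 2"
  then obtain q :: int
    where q: "40 * of_int q + 2 \<le> 8 * of_int n + v" "8 * of_int n + v < 40 * of_int q + 6"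
    by (auto simp: strip_def)
  then have "of_int (8 * n) < (of_int (40 * q + 6) :: rat)" "of_int (40 * q + 2) < (of_int (8 * n + 8) :: rat)"
    using v by simp_all
  then have "n = 5 * q" unfolding of_int_less_iff by presburger
  then show "n mod 5 = 0 \<and> v \<in> {2..<6}" using q by simp
next
  assume *: "n mod 5 = 0 \<and> v \<in> {2..<6}"
  then have "n = 5 * (n div 5)" by auto
  then obtain q where "n = 5 * q" ..
  then show "8 * of_int n + v \<in> strip 2"
    using * by (auto simp: strip_def intro!: exI[of _ q])
qed

text \<open>Maps supported in \<open>strip 2\<close> fix \<open>40q + 1\<close> and
  \<open>40q + 6\<close>, so the left side consists of conditions that they preserve. The lower
  bound is 1 because 2 belongs to the strip.\<close>

lemma strip_interval:
  "y \<in> strip 2 \<and> of_int (40 * q) + 1 < y \<and> y < of_int (40 * q) + 6 \<longleftrightarrow> y + of_int (- 40 * q) \<in> {2..<6}"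
proof (cases "y + of_int (- 40 * q) \<in> {0..<8}")
  case True
  have "y = 8 * of_int (5 * q) + (y + of_int (- 40 * q))" by simp
  then show ?thesis using strip_cell[OF True, of "5 * q"] by auto
qed auto

lemma supported_strip_eq:
  assumes k: "k \<in> Aut" and supp: "supported k (strip l)"
  obtains D where "\<And>q. D q \<in> Aut" "\<And>q. supported (D q) {2..<6}"
    "k = shift \<up> (2 - l) \<bullet> cellwise (\<lambda>n. if n mod 5 = 0 then D (n div 5) else \<one>\<^bsub>Aut_rat\<^esub>) \<bullet> shift \<up> (l - 2)"
proof -
  have shift_pow: "(shift \<up> j) x = x + of_int j" for j x
    by (cases j) (simp_all only: Aut.int_pow_neg int_pow_int shift_nat_pow shift_inv_nat_pow
        shift_aut of_int_of_nat_eq of_int_minus diff_conv_add_uminus)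
  define k' where "k' = shift \<up> (l - 2) \<bullet> k \<bullet> shift \<up> (2 - l)"
  have k': "k' \<in> Aut" using k by (simp add: k'_def)
  have k_eq: "k = shift \<up> (2 - l) \<bullet> k' \<bullet> shift \<up> (l - 2)"
    by (simp add: fun_eq_iff k'_def shift_pow)
  have supp': "supported k' (strip 2)"
    unfolding supported_def
  proof (intro allI impI)
    fix x assume "x \<notin> strip 2"
    then have "x + of_int (l - 2) \<notin> strip l" by (force simp: strip_def)
    then show "k' x = x" using supportedD[OF supp] by (simp add: k'_def shift_pow)
  qed
  define D where "D q v = (if v \<in> {2..<6} then k' (v + of_int (40 * q)) + of_int (- 40 * q) else v)"
    for q v
  have D: "D q \<in> Aut" for q
    unfolding D_def
  proof (rule restrict_aut)
    let ?g = "\<lambda>v. k' (v + of_int (40 * q)) + of_int (- 40 * q)"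
    have "?g = (\<lambda>v. v + of_int (40 * q)) \<bullet> k' \<bullet> (\<lambda>v. v + of_int (- 40 * q))"
      by (simp add: fun_eq_iff)
    then show "?g \<in> Aut"
      by (simp only: Aut.m_closed translation_aut k')
    have fixed: "k' (of_int (40 * q) + 1) = of_int (40 * q) + 1"
        "k' (of_int (40 * q) + 6) = of_int (40 * q) + 6"
      using strip_cell[of 1 "5 * q"] strip_cell[of 6 "5 * q"]
      by (auto intro!: supportedD[OF supp'])
    show mem: "?g v \<in> {2..<6} \<longleftrightarrow> v \<in> {2..<6}" for v
    proof -
      let ?y = "v + of_int (40 * q)"
      have "?g v \<in> {2..<6} \<longleftrightarrow> k' ?y \<in> strip 2 \<and> of_int (40 * q) + 1 < k' ?y \<and> k' ?y < of_int (40 * q) + 6"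
        using strip_interval[of "k' ?y" q] by simp
      also have "\<dots> \<longleftrightarrow> ?y \<in> strip 2 \<and> of_int (40 * q) + 1 < ?y \<and> ?y < of_int (40 * q) + 6"
        using supported_mem_iff[OF k' supp'] Aut_less_iff[OF k', of "of_int (40 * q) + 1" ?y]
          Aut_less_iff[OF k', of ?y "of_int (40 * q) + 6"] unfolding fixed by simp
      also have "\<dots> \<longleftrightarrow> v \<in> {2..<6}" using strip_interval[of ?y q] by simp
      finally show ?thesis .
    qed
    show "v < w \<longleftrightarrow> ?g v < w" if "v \<in> {2..<6}" "w \<notin> {2..<6}" for v w
      using that mem[of v, THEN iffD2, OF that(1)] by auto
  qed
  have supp_D: "supported (D q) {2..<6}" for q by (simp add: supported_def D_def)
  have cellwise: "k' = cellwise (\<lambda>n. if n mod 5 = 0 then D (n div 5) else \<one>\<^bsub>Aut_rat\<^esub>)"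
  proof
    fix x :: rat
    obtain n v where x: "x = 8 * of_int n + v" and v: "v \<in> {0..<8}" by (rule cell_cases)
    show "k' x = cellwise (\<lambda>n. if n mod 5 = 0 then D (n div 5) else \<one>\<^bsub>Aut_rat\<^esub>) x"
    proof (cases "n mod 5 = 0 \<and> v \<in> {2..<6}")
      case True
      define q where "q = n div 5"
      have "n = 5 * q" using True by (auto simp: q_def)
      then show ?thesis
        unfolding x cellwise_apply[OF v] using True by (simp add: D_def add.commute)
    next
      case False
      then have "x \<notin> strip 2" using strip_cell[OF v, of n] by (simp add: x)
      then have "k' x = x" by (rule supportedD[OF supp'])
      then show ?thesis
        unfolding x cellwise_apply[OF v] using False by (auto simp: D_def)
    qed
  qed
  show ?thesis by (rule that[OF D supp_D k_eq[unfolded cellwise]])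
qed

section \<open>Normalising the displacements of a sequence\<close>

text \<open>\<open>g\<close> sends the integers to a grid so sparse that \<open>f i\<close> raises
  grid points of index at least \<open>i\<close> or below \<open>-i\<close> by at most one step. In
  the middle, monotonicity alone costs \<open>2 * i\<close> further steps.\<close>

lemma bounded_displacement_conjugate:
  assumes f: "\<And>i::nat. f i \<in> Aut"
  obtains g where "g \<in> Aut" "\<And>i x. \<bar>(g \<bullet> f i \<bullet> aut_inv g) x - x\<bar> \<le> of_nat (2 * i + 2)"
proof -
  define M where "M i u = \<bar>f i u\<bar> + \<bar>f i (- u)\<bar> + \<bar>aut_inv (f i) u\<bar> + \<bar>aut_inv (f i) (- u)\<bar>" for i u
  \<comment> \<open>Stage \<open>n\<close> takes only \<open>f 0\<close> to \<open>f n\<close> into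
    account, so every sum is finite and one grid serves the whole sequence.\<close>
  define r where "r = rec_nat 0 (\<lambda>n u. u + 1 + (\<Sum>i\<le>n. M i u))"
  have r_0: "r 0 = 0" and r_Suc: "r (Suc n) = r n + 1 + (\<Sum>i\<le>n. M i (r n))" for n
    by (simp_all add: r_def)
  have M: "0 \<le> M i u" for i u by (simp add: M_def)
  have r_step: "r n + 1 \<le> r (Suc n)" for n
    using sum_nonneg[of "{..n}" "\<lambda>i. M i (r n)"] M by (simp add: r_Suc)
  have r_ge: "of_nat n \<le> r n" for n
  proof (induction n)
    case (Suc n)
    then show ?case using r_step[of n] by simp
  qed (simp add: r_0)
  have r_M: "M i (r n) \<le> r (Suc n)" if "i \<le> n" for i n
  proof -
    have "M i (r n) \<le> (\<Sum>i\<le>n. M i (r n))" using that M by (intro member_le_sum) auto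
    moreover have "0 \<le> r n" using r_ge[of n] by (meson of_nat_0_le_iff order_trans)
    ultimately show ?thesis by (simp add: r_Suc)
  qed
  define p where "p n = (if n \<ge> 0 then r (nat n) else - r (nat (- n)))" for n
  have p_step: "p n < p (n + 1)" for n
  proof (cases "n \<ge> 0")
    case True
    then show ?thesis using r_step[of "nat n"] by (simp add: p_def nat_add_distrib)
  next
    case False
    define k where "k = nat (- n - 1)"
    have "nat (- n) = Suc k" "n + 1 = - int k" using False by (simp_all add: k_def)
    then have "p n = - r (Suc k)" "p (n + 1) = - r k" using False by (auto simp: p_def r_0)
    then show ?thesis using r_step[of k] by simp
  qed
  obtain g where g: "g \<in> Aut" "\<And>n. g (of_int n) = p n"
  proof (rule piecewise_linear_aut[of p, OF p_step])
    fix y :: rat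
    obtain m :: nat where m: "\<bar>y\<bar> < of_nat m" using reals_Archimedean2[of "\<bar>y\<bar>"] by auto
    then have "y < p (int m)" "p (- int m) \<le> y"
      using r_ge[of m] r_0 by (auto simp: p_def)
    then show "\<exists>n. y < p n" "\<exists>n. p n \<le> y" by blast+
  qed (rule that)
  have p_mono: "p m \<le> p n \<longleftrightarrow> m \<le> n" for m n
    using Aut_le_iff[OF g(1), of "of_int m" "of_int n"] by (simp add: g(2))
  \<comment> \<open>Upper estimates suffice: the one for the inverse of \<open>f i\<close> yields
    the lower estimate for \<open>f i\<close>.\<close>
  have grid: "\<phi> (p n) \<le> p (n + 2 * int i + 1)"
    if \<phi>: "\<phi> = f i \<or> \<phi> = aut_inv (f i)" for \<phi> i n
  proof -
    have aut: "\<phi> \<in> Aut" using \<phi> f by auto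
    have up: "\<phi> (p n) \<le> p (n + 1)" if "int i \<le> n" for n
    proof -
      have "\<phi> (r (nat n)) \<le> M i (r (nat n))"
        using \<phi> unfolding M_def by (auto simp: add_increasing add_increasing2)
      also have "\<dots> \<le> r (Suc (nat n))" using that by (intro r_M) simp
      finally show ?thesis using that by (simp add: p_def nat_add_distrib)
    qed
    consider "int i \<le> n" | "n + 1 \<le> - int i" | "- int i \<le> n" "n < int i" by linarith
    then show ?thesis
    proof cases
      case 1
      then show ?thesis using up[OF 1] p_mono[of "n + 1" "n + 2 * int i + 1"] by simp
    next
      case 2
      define k where "k = nat (- n - 1)"
      have k: "i \<le> k" "nat (- n) = Suc k" "n + 1 = - int k" using 2 by (simp_all add: k_def)
      have "p (n + 1) = - r k" using r_0 by (auto simp: p_def k(3))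
      moreover have "p n = - r (Suc k)" using 2 k(2) by (simp add: p_def)
      \<comment> \<open>For negative indices the bound on \<open>\<phi>\<close> is read through its
        inverse; hence the terms of \<open>M\<close> at negative arguments.\<close>
      moreover have "- aut_inv \<phi> (- r k) \<le> M i (r k)"
        using \<phi> f unfolding M_def by (auto simp: add_increasing add_increasing2)
      then have "- r (Suc k) \<le> aut_inv \<phi> (- r k)" using r_M[OF k(1)] by linarith
      ultimately have "\<phi> (p n) \<le> p (n + 1)"
        using aut by (metis Aut_le_iff aut_inv_apply(1))
      then show ?thesis using p_mono[of "n + 1" "n + 2 * int i + 1"] by simp
    next
      case 3
      have "\<phi> (p n) \<le> \<phi> (p (int i))" using aut 3 by (simp add: Aut_le_iff p_mono)
      also have "\<dots> \<le> p (int i + 1)" by (rule up) simp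
      also have "\<dots> \<le> p (n + 2 * int i + 1)" using 3 by (simp add: p_mono)
      finally show ?thesis .
    qed
  qed
  have upper: "aut_inv g (\<phi> (g x)) \<le> x + of_nat (2 * i + 2)"
    if \<phi>: "\<phi> = f i \<or> \<phi> = aut_inv (f i)" for \<phi> i x
  proof -
    \<comment> \<open>Rounding up to an integer contributes the last 1 in
      \<open>2 * i + 2\<close>.\<close>
    define n where "n = \<lfloor>x\<rfloor> + 1"
    have n: "x \<le> of_int n" "of_int n \<le> x + 1" by (simp_all add: n_def, linarith)
    have "\<phi> \<in> Aut" using \<phi> f by auto
    then have "\<phi> (g x) \<le> \<phi> (p n)"
      using n(1) g by (simp add: Aut_le_iff flip: g(2))
    also have "\<dots> \<le> g (of_int (n + 2 * int i + 1))" unfolding g(2) by (rule grid[OF \<phi>])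
    finally have "aut_inv g (\<phi> (g x)) \<le> of_int (n + 2 * int i + 1)"
      using g(1) by (simp add: aut_inv_le)
    then show ?thesis using n(2) by simp
  qed
  have "\<bar>(g \<bullet> f i \<bullet> aut_inv g) x - x\<bar> \<le> of_nat (2 * i + 2)" for i x
  proof -
    let ?y = "aut_inv g (f i (g x))"
    have "x = aut_inv g (aut_inv (f i) (g ?y))" using f g by simp
    then have "x \<le> ?y + of_nat (2 * i + 2)" using upper[of "aut_inv (f i)" i ?y] by simp
    then show ?thesis using upper[of "f i" i x] by (simp add: abs_le_iff)
  qed
  then show ?thesis by (rule that[OF g(1)])
qed

section \<open>The universal sequence\<close>

text \<open>The powers of \<open>a\<close> carry \<open>strip 2\<close> to \<open>strip l\<close>.
  Counting factors from the end keeps the indices of the tail when a factor is put in front.\<close>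

primrec assemble ::
    "('g, 'c) monoid_scheme \<Rightarrow> (nat \<Rightarrow> nat) \<Rightarrow> int list \<Rightarrow> 'g \<Rightarrow> 'g \<Rightarrow> 'g" where
  "assemble G idx [] a b = \<one>\<^bsub>G\<^esub>"
| "assemble G idx (l # ls) a b =
     a [^]\<^bsub>G\<^esub> (2 - l) \<otimes>\<^bsub>G\<^esub> decode G (idx (length ls)) a b \<otimes>\<^bsub>G\<^esub> a [^]\<^bsub>G\<^esub> (l - 2)
       \<otimes>\<^bsub>G\<^esub> assemble G idx ls a b"

lemma (in group) expressible_decode:
  assumes "\<alpha> \<noteq> \<beta>" "k > 0"
  shows "expressible G k \<alpha> \<beta> (decode G i)"
  unfolding decode_def[abs_def] Let_def
  by (intro expressible_mult expressible_inv expressible_nat_pow expressible_fst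
      expressible_snd assms)

lemma (in group) expressible_assemble:
  assumes "\<alpha> \<noteq> \<beta>" "k > 0"
  shows "expressible G k \<alpha> \<beta> (assemble G idx ls)"
proof (induction ls)
  case Nil
  then show ?case using expressible_one[OF assms] by simp
next
  case (Cons l ls)
  have "assemble G idx (l # ls) = (\<lambda>a b. a [^] (2 - l) \<otimes> decode G (idx (length ls)) a b
      \<otimes> a [^] (l - 2) \<otimes> assemble G idx ls a b)"
    by (simp add: fun_eq_iff)
  then show ?case
    by (simp only:) (intro Cons expressible_mult expressible_int_pow expressible_decode expressible_fst assms)
qed

text \<open>\<open>idx\<close> and \<open>b\<close> are quantified after \<open>E\<close>, because
  \<open>b\<close> can be built only once the data for the whole sequence are known.\<close>

lemma fragmented_assemble:
  assumes "g \<in> fragmented ls"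
  obtains E where "\<And>s q. E s q \<in> Aut" "\<And>s q. supported (E s q) {2..<6}"
    "\<And>idx b. (\<And>s. decode Aut_rat (idx s) shift b
        = cellwise (\<lambda>n. if n mod 5 = 0 then E s (n div 5) else \<one>\<^bsub>Aut_rat\<^esub>)) \<Longrightarrow>
       assemble Aut_rat idx ls shift b = g"
proof -
  let ?code = "\<lambda>D. cellwise (\<lambda>n. if n mod 5 = 0 then D (n div 5) else \<one>\<^bsub>Aut_rat\<^esub>)"
  \<comment> \<open>With the bound \<open>s < length ls\<close> the tail never reads index
    \<open>length ls\<close>, which is free for the new factor.\<close>
  have "\<exists>E. (\<forall>s q. E s q \<in> Aut \<and> supported (E s q) {2..<6}) \<and>
    (\<forall>idx b. (\<forall>s<length ls. decode Aut_rat (idx s) shift b = ?code (E s)) \<longrightarrow>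
       assemble Aut_rat idx ls shift b = g)"
    using assms
  proof (induction ls arbitrary: g)
    case Nil
    show ?case by (rule exI[of _ "\<lambda>s q. \<one>\<^bsub>Aut_rat\<^esub>"]) (use Nil in \<open>simp del: one_apply\<close>)
  next
    case (Cons l ls)
    then obtain k h where g: "g = k \<bullet> h" and k: "k \<in> Aut" "supported k (strip l)"
      and h: "h \<in> fragmented ls" by auto
    obtain E where E: "\<And>s q. E s q \<in> Aut \<and> supported (E s q) {2..<6}"
      "\<And>idx b. (\<forall>s<length ls. decode Aut_rat (idx s) shift b = ?code (E s)) \<Longrightarrow>
         assemble Aut_rat idx ls shift b = h"
      using Cons.IH[OF h] by blast
    obtain D where D: "\<And>q. D q \<in> Aut" "\<And>q. supported (D q) {2..<6}"
      "k = shift \<up> (2 - l) \<bullet> ?code D \<bullet> shift \<up> (l - 2)"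
      using supported_strip_eq[OF k] by blast
    show ?case
    proof (intro exI[of _ "E(length ls := D)"] conjI allI impI)
      fix idx b
      assume *: "\<forall>s<length (l # ls). decode Aut_rat (idx s) shift b = ?code ((E(length ls := D)) s)"
      have "decode Aut_rat (idx s) shift b = ?code (E s)" if "s < length ls" for s
      proof -
        have "(E(length ls := D)) s = E s" using that by simp
        then show ?thesis using *[rule_format, of s] that by (simp only: length_Cons less_Suc_eq simp_thms)
      qed
      then have "assemble Aut_rat idx ls shift b = h" by (intro E(2)) simp
      moreover have "(E(length ls := D)) (length ls) = D" by simp
      then have "decode Aut_rat (idx (length ls)) shift b = ?code D"
        using *[rule_format, of "length ls"] by (simp only: length_Cons lessI simp_thms)
      ultimately show "assemble Aut_rat idx (l # ls) shift b = g"
        unfolding assemble.simps g D(3) by metis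
    qed (use E(1) D(1,2) in auto)
  qed
  then obtain E where "\<And>s q. E s q \<in> Aut \<and> supported (E s q) {2..<6}"
    and "\<And>idx b. (\<forall>s<length ls. decode Aut_rat (idx s) shift b = ?code (E s)) \<Longrightarrow>
       assemble Aut_rat idx ls shift b = g"
    by blast
  then show ?thesis by (intro that[of E]) simp_all
qed

theorem mainTheorem1:
  fixes A :: "'a set"
  assumes "card A = 2"
  shows "\<exists>w. letter_universal_sequence 2 A Aut_rat w"
proof -
  obtain \<alpha> \<beta> where A: "A = {\<alpha>, \<beta>}" and neq: "\<alpha> \<noteq> \<beta>"
    using assms by (meson card_2_iff)
  define pattern where "pattern i = concat (replicate (2 * i + 2) unit_pattern)" for i
  \<comment> \<open>The pairing gives the \<open>s\<close>-th factor of the \<open>i\<close>-th map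
    a \<open>decode\<close> index of its own.\<close>
  have "\<exists>w. w \<noteq> [] \<and> set w \<subseteq> A \<and> (\<forall>a b. related Aut_rat 40 a b \<longrightarrow>
      word_eval Aut_rat (two_letters \<alpha> a b) w
        = assemble Aut_rat (\<lambda>s. prod_encode (i, s)) (pattern i) a b)" for i
    using Aut.expressible_assemble[OF neq, of 40 "\<lambda>s. prod_encode (i, s)" "pattern i"]
    unfolding expressible_def A by simp
  then obtain w where w: "\<And>i. w i \<noteq> [] \<and> set (w i) \<subseteq> A"
    and eval: "\<And>i a b. related Aut_rat 40 a b \<Longrightarrow>
      word_eval Aut_rat (two_letters \<alpha> a b) (w i)
        = assemble Aut_rat (\<lambda>s. prod_encode (i, s)) (pattern i) a b"
    by metis
  have "\<exists>\<phi>\<in>hom (free_semigroup A) Aut_rat. \<forall>i\<ge>1. \<phi> (w i) = t i" if t: "t \<in> {1..} \<rightarrow> Aut" for t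
  proof -
    \<comment> \<open>Nothing is known about \<open>t 0\<close>, so the identity takes its
      place.\<close>
    define f where "f i = (if i \<ge> 1 then t i else \<one>\<^bsub>Aut_rat\<^esub>)" for i
    have f: "f i \<in> Aut" for i using t by (auto simp: f_def)
    obtain g where g: "g \<in> Aut"
      and bound: "\<And>i x. \<bar>(g \<bullet> f i \<bullet> aut_inv g) x - x\<bar> \<le> of_nat (2 * i + 2)"
      using bounded_displacement_conjugate[of f, OF f] by blast
    have fragmented: "g \<bullet> f i \<bullet> aut_inv g \<in> fragmented (pattern i)" for i
      unfolding pattern_def
      by (rule fragmented_bounded_displacement[OF _ bound]) (intro Aut.m_closed Aut.inv_closed f g)
    define coded where "coded i E \<longleftrightarrow> (\<forall>s q. E s q \<in> Aut \<and> supported (E s q) {2..<6}) \<and>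
      (\<forall>idx b. (\<forall>s. decode Aut_rat (idx s) shift b
          = cellwise (\<lambda>n. if n mod 5 = 0 then E s (n div 5) else \<one>\<^bsub>Aut_rat\<^esub>)) \<longrightarrow>
        assemble Aut_rat idx (pattern i) shift b = g \<bullet> f i \<bullet> aut_inv g)" for i E
    have "\<exists>E. coded i E" for i
      by (rule fragmented_assemble[OF fragmented[of i]]) (unfold coded_def, blast)
    then obtain E where coded: "\<And>i. coded i (E i)" by metis
    then have E: "\<And>i s q. E i s q \<in> Aut" "\<And>i s q. supported (E i s q) {2..<6}"
      by (simp_all add: coded_def)
    obtain b where b: "related Aut_rat 40 shift b"
      and decode: "\<And>j. decode Aut_rat j shift b = cellwise (\<lambda>n. if n mod 5 = 0
        then case_prod E (prod_decode j) (n div 5) else \<one>\<^bsub>Aut_rat\<^esub>)"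
      by (rule code_sequence[of "\<lambda>j. case_prod E (prod_decode j)"])
        (simp_all only: case_prod_beta E)
    \<comment> \<open>The words evaluate to conjugates by \<open>g\<close>; undoing the conjugation
      is a homomorphism and can be absorbed into \<open>\<phi>\<close>.\<close>
    define \<phi> where "\<phi> v = aut_inv g \<bullet> word_eval Aut_rat (two_letters \<alpha> shift b) v \<bullet> g" for v
    have closed: "word_eval Aut_rat (two_letters \<alpha> shift b) v \<in> Aut" for v
      by (rule Aut.word_eval_closed[OF Aut.two_letters_closed[OF b]])
    have "\<phi> \<in> hom (free_semigroup A) Aut_rat"
    proof (rule homI)
      show "\<phi> v \<in> Aut" for v using closed g by (simp add: \<phi>_def del: mult_apply)
      show "\<phi> (u \<otimes>\<^bsub>free_semigroup A\<^esub> v) = \<phi> u \<bullet> \<phi> v" for u v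
        using g by (simp add: \<phi>_def free_semigroup_def fun_eq_iff
            Aut.word_eval_append Aut.two_letters_closed[OF b])
    qed
    moreover have "\<phi> (w i) = t i" if "i \<ge> 1" for i
    proof -
      have "word_eval Aut_rat (two_letters \<alpha> shift b) (w i) = g \<bullet> f i \<bullet> aut_inv g"
        unfolding eval[OF b] 
        by (rule coded[of i, unfolded coded_def, THEN conjunct2, THEN spec, THEN spec, THEN mp])
          (simp add: decode cong: if_cong)
      then show ?thesis using g that by (simp add: \<phi>_def f_def fun_eq_iff)
    qed
    ultimately show ?thesis by blast
  qed
  then show ?thesis
    using w assms A
    by (intro exI[of _ w])
      (auto simp: letter_universal_sequence_def universal_sequence_def universal_as_subset_def
        free_semigroup_def)
qed

end
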